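(* Let $G$ be a 2-connected non-bipartite graph. The following are equivalent: (i) $G$ is odd-$C_3^+$-free; (ii) $G$ has a totally odd circuit basis; (iii) every odd cycle basis of $G$ is totally odd.
   Context: Graphs are finite, may have parallel edges but no loops; $G$ contains $H$ if $H$ is a subgraph of $G$. A circuit is a connected 2-regular graph (identified with its edge set when convenient); a path is a circuit minus an edge. A totally odd subdivision of a graph $H$ is obtained by replacing each edge $e$ of $H$ by a path with an odd number of edges joining the ends of $e$, paths for distinct edges sharing no inner vertices. $C_3^+$ is the triangle $K_3$ with one edge doubled by a parallel edge. An odd-$C_3^+$ is a totally odd subdivision of $C_3^+$, and $G$ is odd-$C_3^+$-free if it contains no odd-$C_3^+$. A cycle of $G$ is an edge-disjoint union of circuits (a subgraph with all degrees even); the cycle space $\mathcal{C}(G)\subseteq\mathbb{F}_2^{E(G)}$ is spanned by incidence vectors of cycles. A cycle basis is a set of cycles whose incidence vectors form a basis of $\mathcal{C}(G)$ over $\mathbb{F}_2$; a circuit basis is a cycle basis consisting of circuits. A cycle is odd if it has an odd number of edges; a cycle basis is odd if all its elements are odd, and an odd cycle basis is totally odd if any two of its elements share an odd number of edges. *)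

theory Defs
  imports Complex_Main "HOL-Library.Z2" "HOL-Library.Function_Algebras" "HOL-Library.Disjoint_Sets"
begin

text \<open>Edges carry their own identity, so distinct edges may have the same set of ends.
  The value of \<open>ends\<close> outside \<open>edges\<close> is irrelevant.\<close>

record ('v, 'e) mgraph =
  verts :: "'v set"
  edges :: "'e set"
  ends :: "'e \<Rightarrow> 'v set"

definition multigraph :: "('v, 'e) mgraph \<Rightarrow> bool" where
  "multigraph G \<longleftrightarrow> finite (verts G) \<and> finite (edges G) \<and>
     (\<forall>e\<in>edges G. ends G e \<subseteq> verts G \<and> card (ends G e) = 2)"

definition subgraph :: "('v, 'e) mgraph \<Rightarrow> ('v, 'e) mgraph \<Rightarrow> bool" where
  "subgraph H G \<longleftrightarrow> multigraph H \<and> verts H \<subseteq> verts G \<and> edges H \<subseteq> edges G \<and>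
     (\<forall>e\<in>edges H. ends H e = ends G e)"

definition degree :: "('v, 'e) mgraph \<Rightarrow> 'v \<Rightarrow> nat" where
  "degree G v = card {e \<in> edges G. v \<in> ends G e}"

definition adjacency :: "('v, 'e) mgraph \<Rightarrow> ('v \<times> 'v) set" where
  "adjacency G = {(u, v). \<exists>e\<in>edges G. ends G e = {u, v}}"

definition connected_graph :: "('v, 'e) mgraph \<Rightarrow> bool" where
  "connected_graph G \<longleftrightarrow> verts G \<noteq> {} \<and>
     (\<forall>u\<in>verts G. \<forall>v\<in>verts G. (u, v) \<in> (adjacency G)\<^sup>*)"

definition delete_vertex :: "('v, 'e) mgraph \<Rightarrow> 'v \<Rightarrow> ('v, 'e) mgraph" where
  "delete_vertex G v =
     \<lparr>verts = verts G - {v}, edges = {e \<in> edges G. v \<notin> ends G e}, ends = ends G\<rparr>"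

definition two_connected :: "('v, 'e) mgraph \<Rightarrow> bool" where
  "two_connected G \<longleftrightarrow> card (verts G) > 2 \<and> connected_graph G \<and>
     (\<forall>v\<in>verts G. connected_graph (delete_vertex G v))"

definition bipartite_graph :: "('v, 'e) mgraph \<Rightarrow> bool" where
  "bipartite_graph G \<longleftrightarrow> (\<exists>X Y. X \<union> Y = verts G \<and> X \<inter> Y = {} \<and>
     (\<forall>e\<in>edges G. \<exists>x\<in>X. \<exists>y\<in>Y. ends G e = {x, y}))"


text \<open>Two parallel edges form a circuit of length two.\<close>

definition circuit_graph :: "('v, 'e) mgraph \<Rightarrow> bool" where
  "circuit_graph C \<longleftrightarrow> multigraph C \<and> connected_graph C \<and> (\<forall>v\<in>verts C. degree C v = 2)"

text \<open>A path is a circuit minus an edge, and its ends are the ends of the missing edge.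
  The missing edge need not be available in the edge type of the path, so it is
  represented by \<open>None\<close>.\<close>

definition add_new_edge :: "('v, 'e) mgraph \<Rightarrow> 'v set \<Rightarrow> ('v, 'e option) mgraph" where
  "add_new_edge P D =
     \<lparr>verts = verts P, edges = insert None (Some ` edges P), ends = case_option D (ends P)\<rparr>"

definition path_joining :: "'v set \<Rightarrow> ('v, 'e) mgraph \<Rightarrow> bool" where
  "path_joining D P \<longleftrightarrow> circuit_graph (add_new_edge P D)"

text \<open>\<open>\<phi>\<close> places the vertices of \<open>H\<close> in \<open>S\<close>, and \<open>P e\<close> is the path
  replacing the edge \<open>e\<close>; its inner vertices are those outside \<open>\<phi> ` ends H e\<close>.\<close>

definition totally_odd_subdivision :: "('a, 'b) mgraph \<Rightarrow> ('v, 'e) mgraph \<Rightarrow> bool" where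
  "totally_odd_subdivision H S \<longleftrightarrow> multigraph S \<and>
     (\<exists>(\<phi> :: 'a \<Rightarrow> 'v) (P :: 'b \<Rightarrow> ('v, 'e) mgraph).
        inj_on \<phi> (verts H) \<and>
        (\<forall>e\<in>edges H. subgraph (P e) S \<and> path_joining (\<phi> ` ends H e) (P e) \<and>
           odd (card (edges (P e))) \<and>
           (verts (P e) - \<phi> ` ends H e) \<inter> \<phi> ` verts H = {}) \<and>
        (\<forall>e\<in>edges H. \<forall>f\<in>edges H. e \<noteq> f \<longrightarrow>
           edges (P e) \<inter> edges (P f) = {} \<and>
           (verts (P e) - \<phi> ` ends H e) \<inter> (verts (P f) - \<phi> ` ends H f) = {}) \<and>
        verts S = \<phi> ` verts H \<union> (\<Union>e\<in>edges H. verts (P e)) \<and>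
        edges S = (\<Union>e\<in>edges H. edges (P e)))"

definition C3_plus :: "(nat, nat) mgraph" where
  "C3_plus = \<lparr>verts = {0, 1, 2}, edges = {0, 1, 2, 3},
     ends = (\<lambda>i. [{0, 1}, {1, 2}, {0, 2}, {0, 2}] ! i)\<rparr>"

definition odd_C3_plus_free :: "('v, 'e) mgraph \<Rightarrow> bool" where
  "odd_C3_plus_free G \<longleftrightarrow> \<not> (\<exists>S. subgraph S G \<and> totally_odd_subdivision C3_plus S)"


text \<open>Circuits and cycles of \<open>G\<close> are identified with their edge sets.\<close>

definition circuits :: "('v, 'e) mgraph \<Rightarrow> 'e set set" where
  "circuits G = {edges C | C. subgraph C G \<and> circuit_graph C}"

definition cycles :: "('v, 'e) mgraph \<Rightarrow> 'e set set" where
  "cycles G = {\<Union>\<C> | \<C>. \<C> \<subseteq> circuits G \<and> disjoint \<C>}"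

text \<open>Vectors over \<open>\<bbbF>\<^sub>2\<close> indexed by the edges of \<open>G\<close> are represented as functions
  on the whole edge type that vanish outside \<open>edges G\<close>; type \<open>bit\<close> is the field
  with two elements.\<close>

definition F2_scale :: "bit \<Rightarrow> ('e \<Rightarrow> bit) \<Rightarrow> ('e \<Rightarrow> bit)" where
  "F2_scale c x = (\<lambda>e. c * x e)"

global_interpretation F2: vector_space F2_scale
  by unfold_locales
    (auto simp only: F2_scale_def fun_eq_iff plus_fun_apply distrib_left distrib_right mult.assoc mult_1_left)

definition incidence_vector :: "'e set \<Rightarrow> ('e \<Rightarrow> bit)" where
  "incidence_vector C = (\<lambda>e. of_bool (e \<in> C))"

definition cycle_space :: "('v, 'e) mgraph \<Rightarrow> ('e \<Rightarrow> bit) set" where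
  "cycle_space G = F2.span (incidence_vector ` cycles G)"

definition cycle_basis :: "('v, 'e) mgraph \<Rightarrow> 'e set set \<Rightarrow> bool" where
  "cycle_basis G B \<longleftrightarrow> B \<subseteq> cycles G \<and> F2.independent (incidence_vector ` B) \<and>
     F2.span (incidence_vector ` B) = cycle_space G"

definition circuit_basis :: "('v, 'e) mgraph \<Rightarrow> 'e set set \<Rightarrow> bool" where
  "circuit_basis G B \<longleftrightarrow> cycle_basis G B \<and> B \<subseteq> circuits G"

definition odd_cycle_basis :: "('v, 'e) mgraph \<Rightarrow> 'e set set \<Rightarrow> bool" where
  "odd_cycle_basis G B \<longleftrightarrow> cycle_basis G B \<and> (\<forall>C\<in>B. odd (card C))"

definition totally_odd_cycle_basis :: "('v, 'e) mgraph \<Rightarrow> 'e set set \<Rightarrow> bool" where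
  "totally_odd_cycle_basis G B \<longleftrightarrow> odd_cycle_basis G B \<and>
     (\<forall>C\<in>B. \<forall>D\<in>B. C \<noteq> D \<longrightarrow> odd (card (C \<inter> D)))"

end

theory Submission
  imports Defs
begin

text \<open>An odd cycle basis is totally odd iff \<open>|C \<inter> D| \<equiv> |C| \<cdot> |D|\<close> modulo 2 holds on the whole
  cycle space, by bilinearity; so the choice of the odd basis is irrelevant.
  An odd-\<open>C\<^sub>3\<^sup>+\<close> is a theta graph with two odd paths and one even path. It violates this
  identity, and it is absent iff every ear of every odd circuit has even length.

  Both remaining points follow from one fact about ears. Let \<open>c\<close> be a 2-colouring of a vertex
  set \<open>S\<close> such that the length of every ear of \<open>S\<close> has the parity predicted by the colours of
  its ends. Adding ears one by one preserves this property, so 2-connectivity extends \<open>c\<close> to a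
  colouring for which every edge that may occur in an ear is bichromatic. If \<open>S\<close> is the vertex
  set of an odd circuit \<open>C\<close> with only even ears and \<open>c\<close> is constant, then every circuit has an even
  number of edges outside \<open>C\<close>. If \<open>S\<close> is the vertex set of an even circuit \<open>D\<close> and \<open>c\<close> is its
  proper colouring, then a non-bipartite graph must contain an ear of the wrong parity, which
  exhibits \<open>D\<close> as a sum of two odd circuits; hence the odd circuits span the cycle space.\<close>

section \<open>Boundaries and colourings\<close>

definition incident :: "('e \<Rightarrow> 'v set) \<Rightarrow> 'e set \<Rightarrow> 'v \<Rightarrow> 'e set" where
  "incident en F x = {e \<in> F. x \<in> en e}"

definition boundary :: "('e \<Rightarrow> 'v set) \<Rightarrow> 'e set \<Rightarrow> 'v set" where
  "boundary en F = {x. odd (card (incident en F x))}"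

definition bichromatic_edges :: "('e \<Rightarrow> 'v set) \<Rightarrow> ('v \<Rightarrow> bool) \<Rightarrow> 'e set" where
  "bichromatic_edges en c = {e. c ` en e = UNIV}"

lemma degree_eq_card_incident: "degree G x = card (incident (ends G) (edges G) x)"
  by (simp add: degree_def incident_def)

lemma finite_incident: "finite F \<Longrightarrow> finite (incident en F x)"
  by (simp add: incident_def)

lemma incident_Un: "incident en (A \<union> B) x = incident en A x \<union> incident en B x"
  by (auto simp: incident_def)

lemma incident_cong: "(\<And>e. e \<in> F \<Longrightarrow> en e = en' e) \<Longrightarrow> incident en F x = incident en' F x"
  by (auto simp: incident_def)

lemma boundary_cong: "(\<And>e. e \<in> F \<Longrightarrow> en e = en' e) \<Longrightarrow> boundary en F = boundary en' F"
  by (simp add: boundary_def cong: incident_cong)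

lemma even_card_sym_diff:
  assumes "finite A" "finite B"
  shows "even (card (sym_diff A B)) \<longleftrightarrow> (even (card A) \<longleftrightarrow> even (card B))"
proof -
  have "card (sym_diff A B) = card (A - B) + card (B - A)"
    using assms by (intro card_Un_disjoint) auto
  moreover have "card A = card (A - B) + card (A \<inter> B)" "card B = card (B - A) + card (A \<inter> B)"
    using assms card_Int_Diff[of A B] card_Int_Diff[of B A] by (auto simp: Int_commute)
  ultimately show ?thesis by auto
qed

lemma boundary_sym_diff:
  assumes "finite A" "finite B"
  shows "boundary en (sym_diff A B) = sym_diff (boundary en A) (boundary en B)"
proof -
  have "incident en (sym_diff A B) x = sym_diff (incident en A x) (incident en B x)" for x
    by (auto simp: incident_def)
  then show ?thesis
    using assms by (auto simp: boundary_def even_card_sym_diff finite_incident)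
qed

lemma boundary_empty: "boundary en {} = {}"
  by (simp add: boundary_def incident_def)

lemma boundary_insert:
  assumes "finite F" "e \<notin> F"
  shows "boundary en (insert e F) = sym_diff (en e) (boundary en F)"
proof -
  have "incident en {e} x = (if x \<in> en e then {e} else {})" for x
    by (auto simp: incident_def)
  then have "boundary en {e} = en e"
    by (auto simp: boundary_def)
  moreover have "insert e F = sym_diff {e} F"
    using assms(2) by auto
  ultimately show ?thesis
    using boundary_sym_diff[of "{e}" F en] assms(1) by simp
qed

lemma boundary_subset: "boundary en F \<subseteq> \<Union>(en ` F)"
proof
  fix x assume "x \<in> boundary en F"
  then have "incident en F x \<noteq> {}"
    by (auto simp: boundary_def)
  then show "x \<in> \<Union>(en ` F)"
    by (auto simp: incident_def)
qed

lemma bichromatic_edges_iff: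
  "en e = {x, y} \<Longrightarrow> e \<in> bichromatic_edges en c \<longleftrightarrow> c x \<noteq> c y"
  by (auto simp: bichromatic_edges_def UNIV_bool)

lemma bichromatic_edges_cong:
  "(\<And>x. x \<in> en e \<Longrightarrow> c x = c' x) \<Longrightarrow>
    e \<in> bichromatic_edges en c \<longleftrightarrow> e \<in> bichromatic_edges en c'"
  by (simp add: bichromatic_edges_def cong: image_cong)

lemma even_card_bichromatic_edges_iff:
  assumes "finite F" "\<And>e. e \<in> F \<Longrightarrow> card (en e) = 2"
  shows "even (card (F \<inter> bichromatic_edges en c)) \<longleftrightarrow> even (card {x \<in> boundary en F. c x})"
proof -
  have "finite (boundary en F) \<and>
      (even (card (F \<inter> bichromatic_edges en c)) \<longleftrightarrow> even (card {x \<in> boundary en F. c x}))"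
    using assms
  proof (induction rule: finite_induct)
    case empty
    show ?case by (simp add: boundary_empty)
  next
    case (insert e F)
    obtain x y where xy: "en e = {x, y}" "x \<noteq> y"
      using insert.prems by (metis card_2_iff insertI1)
    have "{z \<in> en e. c z} = (if c x then {x} else {}) \<union> (if c y then {y} else {})"
      using xy by auto
    then have "even (card {z \<in> en e. c z}) \<longleftrightarrow> e \<notin> bichromatic_edges en c"
      using xy by (auto simp: bichromatic_edges_iff)
    moreover have "{z \<in> boundary en (insert e F). c z} =
        sym_diff {z \<in> en e. c z} {z \<in> boundary en F. c z}"
      unfolding boundary_insert[OF insert.hyps] by auto
    ultimately show ?case
      using insert xy boundary_insert[OF insert.hyps, of en]
        even_card_sym_diff[of "{z \<in> en e. c z}" "{z \<in> boundary en F. c z}"]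
      by auto
  qed
  then show ?thesis ..
qed

section \<open>Arcs\<close>

text \<open>\<open>F\<close> and \<open>W\<close> are the edge set and the vertex set of a path from \<open>u\<close> to \<open>v\<close>.\<close>

inductive arc :: "('e \<Rightarrow> 'v set) \<Rightarrow> 'v \<Rightarrow> 'e set \<Rightarrow> 'v set \<Rightarrow> 'v \<Rightarrow> bool"
  for en :: "'e \<Rightarrow> 'v set" where
  arc_Nil: "arc en u {} {u} u"
| arc_Cons: "en e = {u, w} \<Longrightarrow> arc en w F W v \<Longrightarrow> u \<notin> W \<Longrightarrow>
    arc en u (insert e F) (insert u W) v"

lemma arc_endpoints: "arc en u F W v \<Longrightarrow> u \<in> W \<and> v \<in> W"
  by (induction rule: arc.induct) auto

lemma arc_finite: "arc en u F W v \<Longrightarrow> finite F \<and> finite W"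
  by (induction rule: arc.induct) auto

lemma arc_ends_subset: "arc en u F W v \<Longrightarrow> e \<in> F \<Longrightarrow> en e \<subseteq> W"
  by (induction rule: arc.induct) (auto dest: arc_endpoints)

lemma arc_card_ends: "arc en u F W v \<Longrightarrow> e \<in> F \<Longrightarrow> card (en e) = 2"
proof (induction rule: arc.induct)
  case (arc_Cons d u w F W v)
  have "u \<noteq> w"
    using arc_Cons.hyps(3) arc_endpoints[OF arc_Cons.hyps(2)] by auto
  then show ?case
    using arc_Cons by auto
qed simp

lemma arc_trivial: "arc en u F W u \<Longrightarrow> F = {} \<and> W = {u}"
  by (erule arc.cases) (auto dest: arc_endpoints)

lemma arc_single: "en e = {u, v} \<Longrightarrow> u \<noteq> v \<Longrightarrow> arc en u {e} {u, v} v"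
  using arc_Cons[of en e u v "{}" "{v}" v] by (simp add: arc_Nil)

lemma arc_verts: "arc en u F W v \<Longrightarrow> u \<noteq> v \<Longrightarrow> W = \<Union>(en ` F)"
proof (induction rule: arc.induct)
  case (arc_Cons e u w F W v)
  then show ?case
    using arc_trivial arc_endpoints by (cases "w = v") fastforce+
qed simp

lemma arc_append:
  "arc en u F W v \<Longrightarrow> arc en v F' W' x \<Longrightarrow> W \<inter> W' = {v} \<Longrightarrow> arc en u (F \<union> F') (W \<union> W') x"
proof (induction rule: arc.induct)
  case (arc_Nil u)
  then show ?case
    using arc_endpoints by (metis Un_empty_left insert_absorb insert_is_Un)
next
  case (arc_Cons e u w F W v)
  have "v \<in> W"
    using arc_Cons arc_endpoints by metis
  then have "W \<inter> W' = {v}" "u \<notin> W'"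
    using arc_Cons.prems(2) arc_Cons.hyps(3) by auto
  then show ?case
    using arc_Cons arc.arc_Cons[of en e u w "F \<union> F'" "W \<union> W'" x] by auto
qed

lemma arc_reverse: "arc en u F W v \<Longrightarrow> arc en v F W u"
proof (induction rule: arc.induct)
  case (arc_Nil u)
  show ?case by (rule arc.arc_Nil)
next
  case (arc_Cons e u w F W v)
  have w: "w \<in> W"
    using arc_Cons arc_endpoints by metis
  then have "arc en w {e} {w, u} u"
    using arc_Cons by (intro arc_single) auto
  moreover have "W \<inter> {w, u} = {w}"
    using w arc_Cons by auto
  ultimately have "arc en v (F \<union> {e}) (W \<union> {w, u}) u"
    using arc_Cons arc_append by metis
  moreover have "W \<union> {w, u} = insert u W"
    using w by auto
  ultimately show ?case by simp
qed

lemma arcs_edge_disjoint: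
  assumes "arc en u F W v" "arc en u' F' W' v'" "W \<inter> W' \<subseteq> {x}"
  shows "F \<inter> F' = {}"
proof (rule ccontr)
  assume "F \<inter> F' \<noteq> {}"
  then obtain e where e: "e \<in> F" "e \<in> F'" by auto
  then have "en e \<subseteq> {x}"
    using arc_ends_subset[OF assms(1)] arc_ends_subset[OF assms(2)] assms(3) by blast
  then have "card (en e) \<le> 1"
    using card_mono[of "{x}" "en e"] by simp
  then show False
    using arc_card_ends[OF assms(1) e(1)] by simp
qed

lemma card_arc_append:
  assumes "arc en u F W v" "arc en v F' W' x" "W \<inter> W' = {v}"
  shows "card (F \<union> F') = card F + card F'"
  using arcs_edge_disjoint[OF assms(1,2), of v] assms arc_finite
  by (metis card_Un_disjoint order_refl)

lemma arc_split:
  "arc en u F W v \<Longrightarrow> x \<in> W \<Longrightarrow>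
    \<exists>F1 W1 F2 W2. arc en u F1 W1 x \<and> arc en x F2 W2 v \<and> W1 \<inter> W2 = {x} \<and>
      F1 \<union> F2 = F \<and> W1 \<union> W2 = W"
proof (induction rule: arc.induct)
  case (arc_Nil u)
  then show ?case
    using arc.arc_Nil by fastforce
next
  case (arc_Cons e u w F W v)
  show ?case
  proof (cases "x = u")
    case True
    have "arc en u (insert e F) (insert u W) v"
      using arc_Cons by (intro arc.arc_Cons)
    then show ?thesis
      unfolding True using arc.arc_Nil[of en u]
      by (intro exI[of _ "{}"] exI[of _ "{u}"] exI[of _ "insert e F"] exI[of _ "insert u W"]) auto
  next
    case False
    then obtain F1 W1 F2 W2 where split: "arc en w F1 W1 x" "arc en x F2 W2 v"
        "W1 \<inter> W2 = {x}" "F1 \<union> F2 = F" "W1 \<union> W2 = W"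
      using arc_Cons by blast
    have "arc en u (insert e F1) (insert u W1) x"
      using split arc_Cons by (intro arc.arc_Cons) auto
    then show ?thesis
      using split arc_Cons
      by (intro exI[of _ "insert e F1"] exI[of _ "insert u W1"] exI[of _ F2] exI[of _ W2]) auto
  qed
qed

lemma arc_suffix:
  assumes "arc en u F W v" "x \<in> W" "x \<noteq> u"
  obtains F' W' where "arc en x F' W' v" "F' \<subseteq> F" "W' \<subseteq> W" "u \<notin> W'"
proof -
  obtain F1 W1 F2 W2 where split: "arc en u F1 W1 x" "arc en x F2 W2 v"
      "W1 \<inter> W2 = {x}" "F1 \<union> F2 = F" "W1 \<union> W2 = W"
    using arc_split[OF assms(1,2)] by metis
  have "u \<in> W1"
    using arc_endpoints[OF split(1)] ..
  then have "u \<notin> W2"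
    using split(3) assms(3) by auto
  then show thesis
    using that[OF split(2)] split(4,5) by auto
qed

lemma arc_first_hit:
  "arc en u F W v \<Longrightarrow> v \<in> S \<Longrightarrow> u \<notin> S \<Longrightarrow>
    \<exists>F' W' t. arc en u F' W' t \<and> F' \<subseteq> F \<and> W' \<subseteq> W \<and> W' \<inter> S = {t}"
proof (induction rule: arc.induct)
  case (arc_Cons e u w F W v)
  have w: "w \<in> W"
    using arc_Cons arc_endpoints by metis
  show ?case
  proof (cases "w \<in> S")
    case True
    have "arc en u {e} {u, w} w"
      using arc_Cons w by (intro arc_single) auto
    then show ?thesis
      using True w arc_Cons by (intro exI[of _ "{e}"] exI[of _ "{u, w}"]) auto
  next
    case False
    then obtain F' W' t where hit: "arc en w F' W' t" "F' \<subseteq> F" "W' \<subseteq> W" "W' \<inter> S = {t}"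
      using arc_Cons by blast
    have "arc en u (insert e F') (insert u W') t"
      using hit arc_Cons by (intro arc.arc_Cons) auto
    then show ?thesis
      using hit arc_Cons
      by (intro exI[of _ "insert e F'"] exI[of _ "insert u W'"] exI[of _ t]) auto
  qed
qed simp

lemma arc_edge_joining_endpoints:
  assumes "arc en u F W v" "e \<in> F" "en e = {u, v}"
  shows "W = {u, v}"
  using assms
proof (cases rule: arc.cases)
  case (arc_Cons d w F' W')
  show ?thesis
  proof (cases "e = d")
    case True
    then have "w = v"
      using arc_Cons assms arc_endpoints by (metis doubleton_eq_iff)
    then show ?thesis
      using arc_Cons arc_trivial by fastforce
  next
    case False
    then show ?thesis
      using arc_Cons assms arc_ends_subset by fastforce
  qed
qed simp

lemma card_incident_arc:
  "arc en u F W v \<Longrightarrow> u \<noteq> v \<Longrightarrow>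
    card (incident en F x) = (if x \<notin> W then 0 else if x = u \<or> x = v then 1 else 2)"
proof (induction rule: arc.induct)
  case (arc_Cons e u w F W v)
  have W: "w \<in> W" "v \<in> W"
    using arc_Cons arc_endpoints by metis+
  have "e \<notin> F"
    using arc_Cons arc_ends_subset by fastforce
  moreover have "incident en (insert e F) x =
      (if x \<in> {u, w} then insert e (incident en F x) else incident en F x)"
    using arc_Cons(1) by (auto simp: incident_def)
  ultimately have "card (incident en (insert e F) x) =
      (if x \<in> {u, w} then 1 else 0) + card (incident en F x)"
    using arc_finite[OF arc_Cons.hyps(2)] by (auto simp: incident_def)
  moreover have "F = {} \<and> W = {v}" if "w = v"
    using arc_Cons that arc_trivial by metis
  ultimately show ?case
    using arc_Cons W by (cases "w = v") (auto simp: incident_def)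
qed simp

lemma boundary_arc: "arc en u F W v \<Longrightarrow> u \<noteq> v \<Longrightarrow> boundary en F = {u, v}"
  using arc_endpoints[of en u F W v] by (auto simp: boundary_def card_incident_arc)

lemma odd_card_bichromatic_arc_iff:
  assumes "arc en u F W v" "F \<subseteq> bichromatic_edges en c"
  shows "odd (card F) \<longleftrightarrow> c u \<noteq> c v"
proof (cases "u = v")
  case True
  then show ?thesis
    using arc_trivial assms(1) by fastforce
next
  case False
  have "{x \<in> {u, v}. c x} = (if c u then {u} else {}) \<union> (if c v then {v} else {})"
    by auto
  moreover have "F \<inter> bichromatic_edges en c = F"
    using assms(2) by auto
  ultimately show ?thesis
    using even_card_bichromatic_edges_iff[of F en c] boundary_arc[OF assms(1) False] False
      arc_finite[OF assms(1)] arc_card_ends[OF assms(1)]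
    by auto
qed

lemma arc_colouring_exists:
  "arc en u F W v \<Longrightarrow> \<exists>c. c u = k \<and> F \<subseteq> bichromatic_edges en c"
proof (induction arbitrary: k rule: arc.induct)
  case (arc_Cons e u w F W v)
  then obtain c where c: "c w = (\<not> k)" "F \<subseteq> bichromatic_edges en c" by blast
  have "d \<in> bichromatic_edges en (c(u := k))" if "d \<in> F" for d
  proof -
    have "u \<notin> en d"
      using arc_ends_subset[OF arc_Cons.hyps(2) that] arc_Cons.hyps(3) by auto
    then have "d \<in> bichromatic_edges en (c(u := k)) \<longleftrightarrow> d \<in> bichromatic_edges en c"
      by (intro bichromatic_edges_cong) auto
    then show ?thesis
      using c(2) that by blast
  qed
  moreover have "w \<noteq> u"
    using arc_Cons arc_endpoints by metis
  then have "e \<in> bichromatic_edges en (c(u := k))"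
    using c(1) arc_Cons.hyps(1) by (simp add: bichromatic_edges_iff)
  ultimately have "insert e F \<subseteq> bichromatic_edges en (c(u := k))"
    by blast
  then show ?case
    by (metis fun_upd_same)
qed auto

definition adj :: "('e \<Rightarrow> 'v set) \<Rightarrow> 'e set \<Rightarrow> ('v \<times> 'v) set" where
  "adj en E = {(u, v). \<exists>e\<in>E. en e = {u, v}}"

lemma adjacency_eq_adj: "adjacency G = adj (ends G) (edges G)"
  by (simp add: adjacency_def adj_def)

lemma sym_adj_rtrancl: "sym ((adj en E)\<^sup>*)"
  by (rule sym_rtrancl) (auto simp: sym_def adj_def insert_commute)

lemma arc_imp_reachable: "arc en u F W v \<Longrightarrow> x \<in> W \<Longrightarrow> F \<subseteq> E \<Longrightarrow> (u, x) \<in> (adj en E)\<^sup>*"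
proof (induction rule: arc.induct)
  case (arc_Cons e u w F W v)
  show ?case
  proof (cases "x = u")
    case False
    then have "(w, x) \<in> (adj en E)\<^sup>*"
      using arc_Cons by auto
    moreover have "(u, w) \<in> adj en E"
      using arc_Cons by (auto simp: adj_def)
    ultimately show ?thesis by (rule converse_rtrancl_into_rtrancl[rotated])
  qed simp
qed simp

lemma reachable_imp_arc:
  assumes "(u, v) \<in> (adj en E)\<^sup>*"
  shows "\<exists>F W. arc en u F W v \<and> F \<subseteq> E"
  using assms
proof (induction rule: converse_rtrancl_induct)
  case base
  then show ?case
    using arc_Nil by fastforce
next
  case (step u w)
  then obtain F W e where FW: "arc en w F W v" "F \<subseteq> E" and e: "e \<in> E" "en e = {u, w}"
    by (auto simp: adj_def)
  show ?case
  proof (cases "u \<in> W")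
    case True
    then show ?thesis
      using arc_split[OF FW(1) True] FW(2) by blast
  next
    case False
    then have "arc en u (insert e F) (insert u W) v"
      using FW e by (intro arc_Cons)
    then show ?thesis
      using FW e by blast
  qed
qed

lemma arc_joining_boundary:
  assumes fin: "finite F" and two: "\<And>e. e \<in> F \<Longrightarrow> card (en e) = 2"
    and boundary: "boundary en F = {u, v}" and "u \<noteq> v"
  shows "\<exists>A W. arc en u A W v \<and> A \<subseteq> F"
proof (rule ccontr)
  assume not_joined: "\<not> ?thesis"
  define reachable where "reachable x \<longleftrightarrow> (u, x) \<in> (adj en F)\<^sup>*" for x
  have "\<not> reachable v"
    using not_joined reachable_imp_arc unfolding reachable_def by metis
  then have "{x \<in> boundary en F. reachable x} = {u}"
    using boundary by (auto simp: reachable_def)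
  moreover have "e \<notin> bichromatic_edges en reachable" if e: "e \<in> F" for e
  proof -
    obtain x y where xy: "en e = {x, y}"
      using two[OF e] by (meson card_2_iff)
    then have "(x, y) \<in> adj en F" "(y, x) \<in> adj en F"
      using e by (auto simp: adj_def)
    then have "reachable x \<longleftrightarrow> reachable y"
      unfolding reachable_def by (auto intro: rtrancl_into_rtrancl)
    then show ?thesis
      using xy by (simp add: bichromatic_edges_iff)
  qed
  then have "F \<inter> bichromatic_edges en reachable = {}" by auto
  ultimately show False
    using even_card_bichromatic_edges_iff[of F en reachable] fin two by simp
qed

section \<open>Ears\<close>

lemma multigraph_edge:
  assumes "multigraph G" "e \<in> edges G"
  obtains x y where "ends G e = {x, y}" "x \<noteq> y" "x \<in> verts G" "y \<in> verts G"
  using assms by (metis card_2_iff insert_subset multigraph_def)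

definition ear ::
  "('e \<Rightarrow> 'v set) \<Rightarrow> 'e set \<Rightarrow> 'v set \<Rightarrow> 'v \<Rightarrow> 'e set \<Rightarrow> 'v set \<Rightarrow> 'v \<Rightarrow> bool" where
  "ear en E S u F W v \<longleftrightarrow> arc en u F W v \<and> u \<noteq> v \<and> W \<inter> S = {u, v} \<and> F \<subseteq> E"

definition ear_parity_colouring ::
  "('e \<Rightarrow> 'v set) \<Rightarrow> 'e set \<Rightarrow> 'v set \<Rightarrow> ('v \<Rightarrow> bool) \<Rightarrow> bool" where
  "ear_parity_colouring en E S c \<longleftrightarrow>
    (\<forall>u F W v. ear en E S u F W v \<longrightarrow> (odd (card F) \<longleftrightarrow> c u \<noteq> c v))"

lemma ear_edge_not_inside:
  assumes "ear en E S u F W v" "\<not> W \<subseteq> S" "e \<in> F"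
  shows "\<not> en e \<subseteq> S"
proof
  have arc: "arc en u F W v" and W: "W \<inter> S = {u, v}" and "u \<noteq> v"
    using assms(1) by (simp_all add: ear_def)
  assume "en e \<subseteq> S"
  then have "en e \<subseteq> W \<inter> S"
    using arc_ends_subset[OF arc assms(3)] by simp
  then have "en e = {u, v}"
    using arc_card_ends[OF arc assms(3)] \<open>u \<noteq> v\<close> unfolding W by (intro card_subset_eq) auto
  then have "W = {u, v}"
    by (rule arc_edge_joining_endpoints[OF arc assms(3)])
  then show False
    using W assms(2) by auto
qed

lemma ear_colouring_exists:
  assumes "ear en E S u F W v" "odd (card F) \<longleftrightarrow> c u \<noteq> c v"
  shows "\<exists>c'. (\<forall>x\<in>S. c' x = c x) \<and> F \<subseteq> bichromatic_edges en c'"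
proof -
  have arc: "arc en u F W v" and W: "W \<inter> S = {u, v}"
    using assms(1) by (auto simp: ear_def)
  obtain d where d: "d u = c u" "F \<subseteq> bichromatic_edges en d"
    using arc_colouring_exists[OF arc] by metis
  then have "d v = c v"
    using odd_card_bichromatic_arc_iff[OF arc d(2)] assms(2) by auto
  define c' where "c' x = (if x \<in> W then d x else c x)" for x
  have "c' x = c x" if "x \<in> S" for x
    using that W d(1) \<open>d v = c v\<close> unfolding c'_def by auto
  moreover have "e \<in> bichromatic_edges en c' \<longleftrightarrow> e \<in> bichromatic_edges en d" if "e \<in> F" for e
    using arc_ends_subset[OF arc that] by (intro bichromatic_edges_cong) (auto simp: c'_def)
  ultimately show ?thesis
    using d(2) by blast
qed

definition tail ::
  "('e \<Rightarrow> 'v set) \<Rightarrow> 'e set \<Rightarrow> 'v set \<Rightarrow> 'v set \<Rightarrow> 'v \<Rightarrow> 'e set \<Rightarrow> 'v set \<Rightarrow> 'v \<Rightarrow> bool" where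
  "tail en F U S p A X s \<longleftrightarrow> arc en p A X s \<and> X \<inter> S = {s} \<and> A \<subseteq> F \<and> X \<subseteq> U"

lemma tail_trivial: "p \<in> S \<Longrightarrow> S \<subseteq> U \<Longrightarrow> tail en F U S p {} {p} p"
  by (auto simp: tail_def arc_Nil)

lemma ear_tails_from_split:
  assumes W: "W \<inter> S = {u, v}" and q: "q \<notin> S" and p: "p \<in> S \<union> W" "p \<notin> W1"
    and split: "arc en u F1 W1 q" "arc en q F2 W2 v" "W1 \<inter> W2 = {q}" "F1 \<union> F2 = F" "W1 \<union> W2 = W"
  obtains A X s B Y t where "tail en F (S \<union> W) S p A X s" "tail en F (S \<union> W) S q B Y t" "X \<inter> Y = {}"
proof -
  have subsets: "W1 \<subseteq> W" "W2 \<subseteq> W" "F1 \<subseteq> F" "F2 \<subseteq> F"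
    using split(4,5) by auto
  have mem: "u \<in> W1" "q \<in> W1" "v \<in> W2" "v \<in> S"
    using arc_endpoints split(1,2) W by fast+
  then have "v \<notin> W1"
    using split(3) q by auto
  then have "W1 \<inter> S = {u}"
    using W subsets(1) mem(1) by auto
  then have q_tail: "tail en F (S \<union> W) S q F1 W1 u"
    using arc_reverse[OF split(1)] subsets by (auto simp: tail_def)
  show thesis
  proof (cases "p \<in> S")
    case True
    then show thesis
      using that[OF tail_trivial q_tail] p(2) by simp
  next
    case False
    then have "p \<in> W2"
      using p split(5) by auto
    have "p \<noteq> q"
      using mem(2) p(2) by auto
    obtain A X where A: "arc en p A X v" "A \<subseteq> F2" "X \<subseteq> W2" "q \<notin> X"
      by (rule arc_suffix[OF split(2) \<open>p \<in> W2\<close> \<open>p \<noteq> q\<close>])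
    then have "X \<inter> W1 = {}" "v \<in> X"
      using split(3) arc_endpoints[OF A(1)] by auto
    moreover from this have "u \<notin> X"
      using mem(1) by auto
    ultimately have "X \<inter> S = {v}"
      using W subsets(2) A(3) \<open>v \<in> S\<close> by fast
    then have "tail en F (S \<union> W) S p A X v"
      using A subsets by (auto simp: tail_def)
    then show thesis
      using that[OF _ q_tail \<open>X \<inter> W1 = {}\<close>] by blast
  qed
qed

lemma ear_tails_interior:
  assumes ear: "ear en E S u F W v" and q: "q \<in> W - S" and p: "p \<in> S \<union> W" "p \<noteq> q"
  obtains A X s B Y t where "tail en F (S \<union> W) S p A X s" "tail en F (S \<union> W) S q B Y t" "X \<inter> Y = {}"
proof -
  have arc: "arc en u F W v" and W: "W \<inter> S = {u, v}" "W \<inter> S = {v, u}" and "q \<in> W" "q \<notin> S"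
    using ear q by (auto simp: ear_def)
  obtain F1 W1 F2 W2 where split: "arc en u F1 W1 q" "arc en q F2 W2 v"
      "W1 \<inter> W2 = {q}" "F1 \<union> F2 = F" "W1 \<union> W2 = W"
    using arc_split[OF arc \<open>q \<in> W\<close>] by metis
  show thesis
  proof (cases "p \<in> W1")
    case True
    then have "p \<notin> W2"
      using split(3) p(2) by auto
    have swap: "W2 \<inter> W1 = {q}" "F2 \<union> F1 = F" "W2 \<union> W1 = W"
      using split(3-5) by (simp_all add: Int_commute Un_commute)
    show thesis
      by (rule ear_tails_from_split[OF W(2) \<open>q \<notin> S\<close> p(1) \<open>p \<notin> W2\<close> arc_reverse[OF split(2)]
            arc_reverse[OF split(1)] swap]) (rule that)
  next
    case False
    show thesis
      by (rule ear_tails_from_split[OF W(1) \<open>q \<notin> S\<close> p(1) False split]) (rule that)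
  qed
qed

lemma ear_tails:
  assumes ear: "ear en E S u F W v"
    and p: "p \<in> S \<union> W" and q: "q \<in> S \<union> W" and "p \<noteq> q"
  obtains A X s B Y t where "tail en F (S \<union> W) S p A X s" "tail en F (S \<union> W) S q B Y t" "X \<inter> Y = {}"
proof -
  consider "p \<in> S" "q \<in> S" | "q \<in> W - S" | "p \<in> W - S"
    using p q by blast
  then show thesis
  proof cases
    case 1
    then show thesis
      using \<open>p \<noteq> q\<close> by (intro that[OF tail_trivial tail_trivial]) auto
  next
    case 2
    show thesis
      by (rule ear_tails_interior[OF ear 2 p \<open>p \<noteq> q\<close>]) (rule that)
  next
    case 3
    obtain A X s B Y t
      where "tail en F (S \<union> W) S q A X s" "tail en F (S \<union> W) S p B Y t" "X \<inter> Y = {}"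
      by (rule ear_tails_interior[OF ear 3 q \<open>p \<noteq> q\<close>[symmetric]])
    then show thesis
      using that[of B Y t A X s] by (simp add: Int_commute)
  qed
qed

lemma ear_extend_by_tails:
  assumes ear: "ear en E U p Q Z q" and "S \<subseteq> U" "F \<subseteq> E"
    and tails: "tail en F U S p A X s" "tail en F U S q B Y t" "X \<inter> Y = {}"
  shows "ear en E S s (A \<union> Q \<union> B) (X \<union> Z \<union> Y) t"
    and "card (A \<union> Q \<union> B) = card A + card Q + card B"
proof -
  have Q: "arc en p Q Z q" "Z \<inter> U = {p, q}" "Q \<subseteq> E"
    using ear by (simp_all add: ear_def)
  have A: "arc en s A X p" "X \<inter> S = {s}" "A \<subseteq> F" "X \<subseteq> U"
    and B: "arc en q B Y t" "Y \<inter> S = {t}" "B \<subseteq> F" "Y \<subseteq> U"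
    using tails(1,2) arc_reverse by (auto simp: tail_def)
  have mem: "p \<in> X" "s \<in> X" "q \<in> Y" "t \<in> Y" "p \<in> Z" "q \<in> Z"
    using arc_endpoints A(1) B(1) Q(1) by metis+
  have meet_A: "X \<inter> Z = {p}" and meet_B: "(X \<union> Z) \<inter> Y = {q}"
    using mem Q(2) tails(3) A(4) B(4) by auto
  have AQ: "arc en s (A \<union> Q) (X \<union> Z) q"
    by (rule arc_append[OF A(1) Q(1) meet_A])
  have "Z \<inter> S \<subseteq> {s, t}"
    using Q(2) A(2) B(2) mem \<open>S \<subseteq> U\<close> by auto
  then have "(X \<union> Z \<union> Y) \<inter> S = {s, t}"
    using A(2) B(2) by auto
  moreover have "s \<noteq> t"
    using mem tails(3) by auto
  moreover have "A \<union> Q \<union> B \<subseteq> E"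
    using A(3) B(3) Q(3) \<open>F \<subseteq> E\<close> by auto
  ultimately show "ear en E S s (A \<union> Q \<union> B) (X \<union> Z \<union> Y) t"
    using arc_append[OF AQ B(1) meet_B] by (simp add: ear_def)
  show "card (A \<union> Q \<union> B) = card A + card Q + card B"
    using card_arc_append[OF AQ B(1) meet_B] card_arc_append[OF A(1) Q(1) meet_A] by simp
qed

lemma ear_parity_colouring_Un:
  assumes colouring: "ear_parity_colouring en E S c"
    and ear: "ear en E S u F W v" and F: "F \<subseteq> bichromatic_edges en c"
  shows "ear_parity_colouring en E (S \<union> W) c"
  unfolding ear_parity_colouring_def
proof (intro allI impI)
  fix p Q Z q
  assume Q: "ear en E (S \<union> W) p Q Z q"
  then have p: "p \<in> S \<union> W" and q: "q \<in> S \<union> W" and "p \<noteq> q"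
    by (auto simp: ear_def)
  have "F \<subseteq> E"
    using ear by (simp add: ear_def)
  obtain A X s B Y t
    where A: "tail en F (S \<union> W) S p A X s" and B: "tail en F (S \<union> W) S q B Y t" and "X \<inter> Y = {}"
    by (rule ear_tails[OF ear p q \<open>p \<noteq> q\<close>])
  note extended = ear_extend_by_tails[OF Q Un_upper1 \<open>F \<subseteq> E\<close> A B \<open>X \<inter> Y = {}\<close>]
  have "odd (card A + card Q + card B) \<longleftrightarrow> c s \<noteq> c t"
    using colouring extended unfolding ear_parity_colouring_def by metis
  moreover have arcs: "arc en p A X s" "arc en q B Y t"
    and "A \<subseteq> bichromatic_edges en c" "B \<subseteq> bichromatic_edges en c"
    using A B F by (auto simp: tail_def)
  then have "odd (card A) \<longleftrightarrow> c p \<noteq> c s" "odd (card B) \<longleftrightarrow> c q \<noteq> c t"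
    using arcs[THEN odd_card_bichromatic_arc_iff] by simp_all
  ultimately show "odd (card Q) \<longleftrightarrow> c p \<noteq> c q" by auto
qed

lemma ear_parity_colouring_cong:
  assumes "\<And>x. x \<in> S \<Longrightarrow> c x = c' x"
  shows "ear_parity_colouring en E S c \<longleftrightarrow> ear_parity_colouring en E S c'"
proof -
  have "c u = c' u \<and> c v = c' v" if "ear en E S u F W v" for u F W v
    using that assms by (auto simp: ear_def)
  then show ?thesis
    unfolding ear_parity_colouring_def by metis
qed

lemma arc_verts_subset:
  assumes "multigraph G" "arc (ends G) u F W v" "u \<noteq> v" "F \<subseteq> edges G"
  shows "W \<subseteq> verts G"
  using arc_verts[OF assms(2,3)] assms(1,4) by (auto simp: multigraph_def)

lemma rtrancl_leaves_set:
  assumes "(a, b) \<in> r\<^sup>*" "a \<in> S" "b \<notin> S"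
  shows "\<exists>x y. (x, y) \<in> r \<and> x \<in> S \<and> y \<notin> S"
  using assms by (induction rule: rtrancl_induct) auto

lemma two_connected_arc_avoiding:
  assumes "two_connected G" "s \<in> verts G" "x \<in> verts G" "t \<in> verts G" "x \<noteq> s" "t \<noteq> s" "x \<noteq> t"
  shows "\<exists>F W. arc (ends G) x F W t \<and> F \<subseteq> edges G \<and> s \<notin> W"
proof -
  have "connected_graph (delete_vertex G s)"
    using assms(1,2) by (simp add: two_connected_def)
  then have "(x, t) \<in> (adj (ends G) {e \<in> edges G. s \<notin> ends G e})\<^sup>*"
    using assms(3-6) by (auto simp: connected_graph_def adjacency_eq_adj delete_vertex_def)
  from reachable_imp_arc[OF this] obtain F W
    where F: "arc (ends G) x F W t" "F \<subseteq> {e \<in> edges G. s \<notin> ends G e}"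
    by blast
  then have "s \<notin> W"
    using arc_verts[OF F(1) assms(7)] by auto
  then show ?thesis
    using F by auto
qed

lemma two_connected_ear_exists:
  assumes G: "multigraph G" "two_connected G"
    and S: "S \<subset> verts G" "a \<in> S" "b \<in> S" "a \<noteq> b"
  shows "\<exists>u F W v. ear (ends G) (edges G) S u F W v \<and> \<not> W \<subseteq> S"
proof -
  obtain z where z: "z \<in> verts G" "z \<notin> S"
    using S by blast
  have "(a, z) \<in> (adjacency G)\<^sup>*"
    using G S z by (auto simp: two_connected_def connected_graph_def)
  then obtain s x where sx: "(s, x) \<in> adjacency G" "s \<in> S" "x \<notin> S"
    using rtrancl_leaves_set[OF _ S(2) z(2)] by blast
  then obtain e where e: "e \<in> edges G" "ends G e = {s, x}"
    by (auto simp: adjacency_def)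
  obtain t where t: "t \<in> S" "t \<noteq> s"
    using S by metis
  have "x \<in> verts G" "s \<in> verts G" "t \<in> verts G" "x \<noteq> s" "x \<noteq> t"
    using e G sx S t by (auto simp: multigraph_def)
  then obtain F W where F: "arc (ends G) x F W t" "F \<subseteq> edges G" "s \<notin> W"
    using two_connected_arc_avoiding[OF G(2)] t(2) by blast
  obtain F' W' t'
    where hit: "arc (ends G) x F' W' t'" "F' \<subseteq> F" "W' \<subseteq> W" "W' \<inter> S = {t'}"
    using arc_first_hit[OF F(1) t(1) sx(3)] by blast
  then have "x \<in> W'" "t' \<in> W'" "s \<notin> W'"
    using arc_endpoints F(3) by fast+
  then have "arc (ends G) s (insert e F') (insert s W') t'" "s \<noteq> t'"
    using e hit by (auto intro: arc_Cons[of "ends G" e s x])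
  moreover have "insert s W' \<inter> S = {s, t'}" "insert e F' \<subseteq> edges G"
    using hit F(2) sx(2) e(1) by auto
  ultimately have "ear (ends G) (edges G) S s (insert e F') (insert s W') t'"
    by (simp add: ear_def)
  then show ?thesis
    using sx(3) \<open>x \<in> W'\<close> by blast
qed

lemma ear_parity_colouring_verts:
  assumes G: "multigraph G" and E: "E \<subseteq> edges G"
    and colouring: "ear_parity_colouring (ends G) E (verts G) c"
  shows "E \<subseteq> bichromatic_edges (ends G) c"
proof
  fix e assume e: "e \<in> E"
  then obtain x y where xy: "ends G e = {x, y}" "x \<noteq> y" "x \<in> verts G" "y \<in> verts G"
    using multigraph_edge[OF G] E by blast
  then have "ear (ends G) E (verts G) x {e} {x, y} y"
    using e arc_single[of "ends G"] by (auto simp: ear_def)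
  then have "c x \<noteq> c y"
    using colouring unfolding ear_parity_colouring_def by fastforce
  then show "e \<in> bichromatic_edges (ends G) c"
    using xy by (simp add: bichromatic_edges_iff)
qed

lemma ear_parity_colouring_extends:
  assumes G: "multigraph G" "two_connected G"
    and S: "S \<subseteq> verts G" "a \<in> S" "b \<in> S" "a \<noteq> b"
    and E: "E \<subseteq> edges G" "\<And>e. e \<in> edges G - E \<Longrightarrow> ends G e \<subseteq> S"
    and colouring: "ear_parity_colouring (ends G) E S c"
  shows "\<exists>c'. (\<forall>x\<in>S. c' x = c x) \<and> E \<subseteq> bichromatic_edges (ends G) c'"
  using S E(2) colouring
proof (induction "card (verts G - S)" arbitrary: S c rule: less_induct)
  case less
  note S = less.prems(1-4) and E_outside = less.prems(5) and colouring = less.prems(6)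
  show ?case
  proof (cases "S = verts G")
    case True
    then show ?thesis
      using ear_parity_colouring_verts[OF G(1) E(1)] colouring by blast
  next
    case False
    then obtain u F W v where ear: "ear (ends G) (edges G) S u F W v" "\<not> W \<subseteq> S"
      using two_connected_ear_exists[OF G, of S a b] S by blast
    then have "F \<subseteq> E"
      using ear_edge_not_inside[OF ear] E_outside unfolding ear_def by blast
    then have ear_E: "ear (ends G) E S u F W v"
      using ear(1) by (simp add: ear_def)
    then have "odd (card F) \<longleftrightarrow> c u \<noteq> c v"
      using colouring unfolding ear_parity_colouring_def by blast
    then obtain d where d: "\<forall>x\<in>S. d x = c x" "F \<subseteq> bichromatic_edges (ends G) d"
      using ear_colouring_exists[OF ear_E, of c] by blast
    have "ear_parity_colouring (ends G) E S d"
      using colouring d(1) ear_parity_colouring_cong[of S d c "ends G" E] by simp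
    then have "ear_parity_colouring (ends G) E (S \<union> W) d"
      by (rule ear_parity_colouring_Un[OF _ ear_E d(2)])
    moreover have "W \<subseteq> verts G"
      using ear(1) arc_verts_subset[OF G(1)] unfolding ear_def by blast
    moreover from this have "card (verts G - (S \<union> W)) < card (verts G - S)"
      using G(1) ear(2) by (intro psubset_card_mono) (auto simp: multigraph_def)
    ultimately obtain c' where
      "\<forall>x\<in>S \<union> W. c' x = d x" "E \<subseteq> bichromatic_edges (ends G) c'"
      using less.hyps[of "S \<union> W" d] S E_outside by blast
    then show ?thesis
      using d(1) by auto
  qed
qed

section \<open>Circuits\<close>

definition edge_induced :: "('e \<Rightarrow> 'v set) \<Rightarrow> 'e set \<Rightarrow> ('v, 'e) mgraph" where
  "edge_induced en F = \<lparr>verts = \<Union>(en ` F), edges = F, ends = en\<rparr>"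

definition internally_disjoint_arcs ::
  "('e \<Rightarrow> 'v set) \<Rightarrow> 'v \<Rightarrow> 'e set \<Rightarrow> 'v set \<Rightarrow> 'e set \<Rightarrow> 'v set \<Rightarrow> 'v \<Rightarrow> bool" where
  "internally_disjoint_arcs en u A WA B WB v \<longleftrightarrow> arc en u A WA v \<and> arc en u B WB v \<and>
    u \<noteq> v \<and> WA \<inter> WB = {u, v} \<and> A \<inter> B = {}"

lemma edge_induced_simps [simp]:
  "verts (edge_induced en F) = \<Union>(en ` F)"
  "edges (edge_induced en F) = F"
  "ends (edge_induced en F) = en"
  by (simp_all add: edge_induced_def)

lemma subgraph_edge_induced:
  assumes "multigraph G" "F \<subseteq> edges G"
  shows "subgraph (edge_induced (ends G) F) G"
proof -
  have "\<Union>(ends G ` F) \<subseteq> verts G" "finite F"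
    using assms by (auto simp: multigraph_def finite_subset)
  then show ?thesis
    using assms by (auto simp: subgraph_def multigraph_def intro: finite_subset)
qed

lemma card_internally_disjoint_arcs:
  "internally_disjoint_arcs en u A WA B WB v \<Longrightarrow> card (A \<union> B) = card A + card B"
  using arc_finite unfolding internally_disjoint_arcs_def by (metis card_Un_disjoint)

lemma internally_disjoint_arcs_verts:
  assumes "internally_disjoint_arcs en u A WA B WB v"
  shows "\<Union>(en ` (A \<union> B)) = WA \<union> WB"
  using assms arc_verts[of en u A WA v] arc_verts[of en u B WB v]
  by (simp add: internally_disjoint_arcs_def)

lemma internally_disjoint_arcs_circuit_graph:
  assumes disjoint: "internally_disjoint_arcs en u A WA B WB v"
  shows "circuit_graph (edge_induced en (A \<union> B))"
proof -
  have A: "arc en u A WA v" and B: "arc en u B WB v" and "u \<noteq> v"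
    and W: "WA \<inter> WB = {u, v}" and AB: "A \<inter> B = {}"
    using disjoint by (auto simp: internally_disjoint_arcs_def)
  let ?C = "edge_induced en (A \<union> B)"
  have verts: "verts ?C = WA \<union> WB"
    using internally_disjoint_arcs_verts[OF disjoint] by simp
  have fin: "finite A" "finite B" "finite (WA \<union> WB)"
    using arc_finite[OF A] arc_finite[OF B] by auto
  have "multigraph ?C"
    unfolding multigraph_def verts
    using fin arc_ends_subset[OF A] arc_ends_subset[OF B] arc_card_ends[OF A] arc_card_ends[OF B]
    by auto
  moreover have "degree ?C x = 2" if x: "x \<in> verts ?C" for x
  proof -
    have "incident en A x \<inter> incident en B x = {}"
      using AB by (auto simp: incident_def)
    then have "degree ?C x = card (incident en A x) + card (incident en B x)"
      using fin by (simp add: degree_eq_card_incident incident_Un finite_incident card_Un_disjoint)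
    then show ?thesis
      using card_incident_arc[OF A \<open>u \<noteq> v\<close>, of x] card_incident_arc[OF B \<open>u \<noteq> v\<close>, of x] W x
      unfolding verts by (auto split: if_splits)
  qed
  moreover have "connected_graph ?C"
  proof -
    have reach: "(u, x) \<in> (adj en (A \<union> B))\<^sup>*" if "x \<in> verts ?C" for x
      using that arc_imp_reachable[OF A, of x "A \<union> B"] arc_imp_reachable[OF B, of x "A \<union> B"]
      unfolding verts by auto
    have "(x, y) \<in> (adj en (A \<union> B))\<^sup>*" if "x \<in> verts ?C" "y \<in> verts ?C" for x y
      using reach[OF that(1)] reach[OF that(2)] sym_adj_rtrancl by (meson rtrancl_trans symD)
    moreover have "u \<in> verts ?C"
      using W unfolding verts by auto
    ultimately show ?thesis
      unfolding connected_graph_def adjacency_eq_adj by auto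
  qed
  ultimately show ?thesis
    by (simp add: circuit_graph_def)
qed

lemma card_incident_circuit_graph:
  assumes "circuit_graph C"
  shows "card (incident (ends C) (edges C) x) = (if x \<in> verts C then 2 else 0)"
proof (cases "x \<in> verts C")
  case True
  then show ?thesis
    using assms by (simp add: circuit_graph_def degree_eq_card_incident)
next
  case False
  then have "incident (ends C) (edges C) x = {}"
    using assms by (auto simp: circuit_graph_def multigraph_def incident_def)
  then show ?thesis
    using False by simp
qed

lemma boundary_circuit_graph: "circuit_graph C \<Longrightarrow> boundary (ends C) (edges C) = {}"
  by (simp add: boundary_def card_incident_circuit_graph)

lemma circuit_graph_verts:
  assumes "circuit_graph C"
  shows "verts C = \<Union>(ends C ` edges C)"
proof
  show "verts C \<subseteq> \<Union>(ends C ` edges C)"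
  proof
    fix x assume "x \<in> verts C"
    then have "incident (ends C) (edges C) x \<noteq> {}"
      using card_incident_circuit_graph[OF assms, of x] by auto
    then show "x \<in> \<Union>(ends C ` edges C)"
      by (auto simp: incident_def)
  qed
  show "\<Union>(ends C ` edges C) \<subseteq> verts C"
    using assms by (auto simp: circuit_graph_def multigraph_def)
qed

lemma circuits_iff:
  assumes G: "multigraph G"
  shows "D \<in> circuits G \<longleftrightarrow> D \<subseteq> edges G \<and> circuit_graph (edge_induced (ends G) D)"
proof
  assume "D \<in> circuits G"
  then obtain C where C: "subgraph C G" "circuit_graph C" "edges C = D"
    by (auto simp: circuits_def)
  then have ends: "ends C e = ends G e" if "e \<in> D" for e
    using that by (auto simp: subgraph_def)
  let ?C = "edge_induced (ends G) D"
  have "degree ?C x = degree C x" for x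
    using incident_cong[of D "ends C" "ends G", OF ends] C(3) by (simp add: degree_eq_card_incident)
  moreover have "verts ?C = verts C" "adjacency ?C = adjacency C"
    using circuit_graph_verts[OF C(2)] C(3) ends by (auto simp: adjacency_def)
  moreover have "D \<subseteq> edges G"
    using C(1,3) by (auto simp: subgraph_def)
  ultimately show "D \<subseteq> edges G \<and> circuit_graph ?C"
    using C(2) subgraph_edge_induced[OF G, of D]
    by (simp add: circuit_graph_def connected_graph_def subgraph_def)
next
  assume "D \<subseteq> edges G \<and> circuit_graph (edge_induced (ends G) D)"
  then show "D \<in> circuits G"
    unfolding circuits_def using subgraph_edge_induced[OF G, of D]
    by (intro CollectI exI[of _ "edge_induced (ends G) D"]) simp
qed

lemma internally_disjoint_arcs_circuit:
  assumes "multigraph G" "internally_disjoint_arcs (ends G) u A WA B WB v" "A \<union> B \<subseteq> edges G"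
  shows "A \<union> B \<in> circuits G"
  using assms internally_disjoint_arcs_circuit_graph by (simp add: circuits_iff)

lemma boundary_circuit: "multigraph G \<Longrightarrow> D \<in> circuits G \<Longrightarrow> boundary (ends G) D = {}"
  using boundary_circuit_graph[of "edge_induced (ends G) D"] by (simp add: circuits_iff)

lemma circuit_two_vertices:
  assumes "multigraph G" "D \<in> circuits G"
  obtains a b where "a \<in> \<Union>(ends G ` D)" "b \<in> \<Union>(ends G ` D)" "a \<noteq> b"
proof -
  have "D \<subseteq> edges G" "D \<noteq> {}"
    using assms by (auto simp: circuits_iff circuit_graph_def connected_graph_def)
  then obtain e where e: "e \<in> D" "e \<in> edges G" by blast
  then obtain x y where "ends G e = {x, y}" "x \<noteq> y"
    using multigraph_edge[OF assms(1)] by metis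
  then show thesis
    using that[of x y] e(1) by blast
qed

lemma incident_circuit_subgraph:
  assumes D: "circuit_graph D" "subgraph D C" and C: "circuit_graph C" and x: "x \<in> verts D"
  shows "incident (ends C) (edges C) x \<subseteq> edges D"
proof -
  have "incident (ends C) (edges D) x = incident (ends D) (edges D) x"
    using D(2) by (intro incident_cong) (simp add: subgraph_def)
  then have "card (incident (ends C) (edges D) x) = card (incident (ends C) (edges C) x)"
    using x D(2) card_incident_circuit_graph[OF D(1)] card_incident_circuit_graph[OF C]
    by (auto simp: subgraph_def)
  moreover have "incident (ends C) (edges D) x \<subseteq> incident (ends C) (edges C) x"
    using D(2) by (auto simp: incident_def subgraph_def)
  moreover have "finite (edges C)"
    using C by (simp add: circuit_graph_def multigraph_def)
  ultimately have "incident (ends C) (edges D) x = incident (ends C) (edges C) x"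
    by (intro card_subset_eq finite_incident)
  then show ?thesis
    by (auto simp: incident_def)
qed

lemma circuit_subgraph_of_circuit:
  assumes D: "circuit_graph D" "subgraph D C" and C: "circuit_graph C"
  shows "edges D = edges C"
proof -
  note incident = incident_circuit_subgraph[OF D C]
  obtain u where u: "u \<in> verts D" "u \<in> verts C"
    using D by (auto simp: circuit_graph_def connected_graph_def subgraph_def)
  have "x \<in> verts D" if "(u, x) \<in> (adjacency C)\<^sup>*" for x
    using that
  proof (induction rule: rtrancl_induct)
    case (step y z)
    then obtain e where e: "e \<in> edges C" "ends C e = {y, z}"
      by (auto simp: adjacency_def)
    then have "e \<in> edges D"
      using incident[OF step.IH] by (auto simp: incident_def)
    then have "ends D e = {y, z}" "ends D e \<subseteq> verts D"
      using e D by (auto simp: subgraph_def circuit_graph_def multigraph_def)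
    then show ?case by auto
  qed (rule u)
  then have "verts C \<subseteq> verts D"
    using u(2) C by (auto simp: circuit_graph_def connected_graph_def)
  have "e \<in> edges D" if e: "e \<in> edges C" for e
  proof -
    obtain x y where xy: "ends C e = {x, y}" "x \<in> verts C"
      using multigraph_edge e C unfolding circuit_graph_def by metis
    then have "e \<in> incident (ends C) (edges C) x"
      using e by (simp add: incident_def)
    then show ?thesis
      using incident xy(2) \<open>verts C \<subseteq> verts D\<close> by blast
  qed
  then show ?thesis
    using D(2) by (auto simp: subgraph_def)
qed

lemma edge_disjoint_arcs_internally_disjoint:
  assumes "finite F" and max_degree: "\<And>x. card (incident en F x) \<le> 2"
    and A: "arc en u A WA v" "A \<subseteq> F" and B: "arc en u B WB v" "B \<subseteq> F"
    and "A \<inter> B = {}" and "u \<noteq> v"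
  shows "internally_disjoint_arcs en u A WA B WB v"
proof -
  have "x = u \<or> x = v" if x: "x \<in> WA" "x \<in> WB" for x
  proof (rule ccontr)
    assume "\<not> (x = u \<or> x = v)"
    then have "card (incident en A x) = 2" "card (incident en B x) = 2"
      using x card_incident_arc A(1) B(1) \<open>u \<noteq> v\<close> by metis+
    moreover have "incident en A x \<inter> incident en B x = {}"
      "incident en A x \<union> incident en B x \<subseteq> incident en F x"
      using A(2) B(2) \<open>A \<inter> B = {}\<close> by (auto simp: incident_def)
    moreover have "finite (incident en A x)" "finite (incident en B x)" "finite (incident en F x)"
      using arc_finite[OF A(1)] arc_finite[OF B(1)] \<open>finite F\<close> by (simp_all add: finite_incident)
    ultimately have "4 \<le> card (incident en F x)"
      using card_Un_disjoint[of "incident en A x" "incident en B x"]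
        card_mono[of "incident en F x" "incident en A x \<union> incident en B x"]
      by simp
    then show False
      using max_degree[of x] by simp
  qed
  then show ?thesis
    using A(1) B(1) \<open>A \<inter> B = {}\<close> \<open>u \<noteq> v\<close> arc_endpoints[OF A(1)] arc_endpoints[OF B(1)]
    by (auto simp: internally_disjoint_arcs_def)
qed

lemma circuit_split:
  assumes G: "multigraph G" and D: "D \<in> circuits G"
    and uv: "u \<in> \<Union>(ends G ` D)" "v \<in> \<Union>(ends G ` D)" "u \<noteq> v"
  shows "\<exists>A WA B WB. internally_disjoint_arcs (ends G) u A WA B WB v \<and> A \<union> B = D"
proof -
  let ?C = "edge_induced (ends G) D"
  have C: "circuit_graph ?C" and DG: "D \<subseteq> edges G"
    using D by (auto simp: circuits_iff[OF G])
  then have mC: "multigraph ?C"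
    by (simp add: circuit_graph_def)
  then have "finite D"
    by (simp add: multigraph_def)
  have "(u, v) \<in> (adj (ends G) D)\<^sup>*"
    using C uv(1,2) unfolding circuit_graph_def connected_graph_def adjacency_eq_adj
      edge_induced_simps
    by blast
  from reachable_imp_arc[OF this] obtain A WA where A: "arc (ends G) u A WA v" "A \<subseteq> D"
    by blast
  have "D - A = sym_diff D A"
    using A(2) by auto
  then have "boundary (ends G) (D - A) = {u, v}"
    using boundary_sym_diff[OF \<open>finite D\<close> finite_subset[OF A(2) \<open>finite D\<close>], of "ends G"]
      boundary_circuit[OF G D] boundary_arc[OF A(1) uv(3)]
    by simp
  moreover have "card (ends G e) = 2" if "e \<in> D - A" for e
    using that DG G by (auto simp: multigraph_def)
  ultimately obtain B WB where B: "arc (ends G) u B WB v" "B \<subseteq> D - A"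
    using arc_joining_boundary[of "D - A" "ends G" u v] \<open>finite D\<close> uv(3) by blast
  moreover have "card (incident (ends G) D x) \<le> 2" for x
    using card_incident_circuit_graph[OF C, of x] by (simp split: if_splits)
  ultimately have disjoint: "internally_disjoint_arcs (ends G) u A WA B WB v"
    using A \<open>finite D\<close> uv(3) by (intro edge_disjoint_arcs_internally_disjoint[of D]) auto
  have "subgraph (edge_induced (ends G) (A \<union> B)) ?C"
    using subgraph_edge_induced[OF mC, of "A \<union> B"] A(2) B(2) by auto
  then have "A \<union> B = D"
    using circuit_subgraph_of_circuit[OF internally_disjoint_arcs_circuit_graph[OF disjoint] _ C]
    by simp
  then show ?thesis
    using disjoint by blast
qed

lemma boundaryless_contains_circuit:
  assumes G: "multigraph G" and F: "F \<subseteq> edges G" "F \<noteq> {}" "boundary (ends G) F = {}"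
  shows "\<exists>D\<in>circuits G. D \<subseteq> F"
proof -
  have "finite F"
    using F(1) G by (metis finite_subset multigraph_def)
  obtain e where e: "e \<in> F"
    using F(2) by blast
  obtain a b where ab: "ends G e = {a, b}" "a \<noteq> b"
    using multigraph_edge[OF G subsetD[OF F(1) e]] by metis
  have "sym_diff (ends G e) (boundary (ends G) (F - {e})) = {}"
    using boundary_insert[of "F - {e}" e "ends G"] \<open>finite F\<close> e F(3) by (simp add: insert_absorb)
  then have "boundary (ends G) (F - {e}) = {a, b}"
    using ab by auto
  moreover have "card (ends G d) = 2" if "d \<in> F - {e}" for d
    using that F(1) G by (auto simp: multigraph_def)
  ultimately obtain A W where A: "arc (ends G) a A W b" "A \<subseteq> F - {e}"
    using arc_joining_boundary[of "F - {e}" "ends G" a b] \<open>finite F\<close> ab(2) by blast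
  have "arc (ends G) a {e} {a, b} b"
    using ab by (rule arc_single)
  then have "internally_disjoint_arcs (ends G) a A W {e} {a, b} b"
    using A ab(2) arc_endpoints[OF A(1)] by (auto simp: internally_disjoint_arcs_def)
  moreover have subset: "A \<union> {e} \<subseteq> F"
    using A(2) e by auto
  ultimately have "A \<union> {e} \<in> circuits G"
    using F(1) by (intro internally_disjoint_arcs_circuit[OF G]) auto
  with subset show ?thesis
    by (rule bexI)
qed

lemma circuit_ear_split:
  assumes G: "multigraph G" and D: "D \<in> circuits G"
    and ear: "ear (ends G) (edges G - D) (\<Union>(ends G ` D)) u F W v"
  shows "\<exists>A WA B WB. internally_disjoint_arcs (ends G) u A WA B WB v \<and>
    internally_disjoint_arcs (ends G) u A WA F W v \<and>
    internally_disjoint_arcs (ends G) u B WB F W v \<and> A \<union> B = D"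
proof -
  define V where "V = \<Union>(ends G ` D)"
  have F: "arc (ends G) u F W v" "u \<noteq> v" "W \<inter> V = {u, v}" "F \<inter> D = {}"
    using ear by (auto simp: ear_def V_def)
  then have "u \<in> V" "v \<in> V" by auto
  then obtain A WA B WB
    where split: "internally_disjoint_arcs (ends G) u A WA B WB v" "A \<union> B = D"
    using circuit_split[OF G D] F(2) unfolding V_def by metis
  have V: "V = WA \<union> WB"
    using internally_disjoint_arcs_verts[OF split(1)] split(2) by (simp add: V_def)
  have "u \<in> WA" "v \<in> WA" "u \<in> WB" "v \<in> WB"
    using split(1) by (auto simp: internally_disjoint_arcs_def)
  then have "WA \<inter> W = {u, v}" "WB \<inter> W = {u, v}"
    using F(3) unfolding V by auto
  moreover have "A \<inter> F = {}" "B \<inter> F = {}"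
    using F(4) split(2) by auto
  ultimately have "internally_disjoint_arcs (ends G) u A WA F W v"
    "internally_disjoint_arcs (ends G) u B WB F W v"
    using split(1) F(1) by (simp_all add: internally_disjoint_arcs_def)
  then show ?thesis
    using split by blast
qed

lemma circuit_ear_parity_colouring_extends:
  assumes G: "multigraph G" "two_connected G" and D: "D \<in> circuits G"
    and colouring: "ear_parity_colouring (ends G) (edges G - D) (\<Union>(ends G ` D)) c"
  obtains c' where "\<forall>x\<in>\<Union>(ends G ` D). c' x = c x"
    "edges G - D \<subseteq> bichromatic_edges (ends G) c'"
proof -
  have "D \<subseteq> edges G"
    using D by (simp add: circuits_iff[OF G(1)])
  then have "\<Union>(ends G ` D) \<subseteq> verts G"
    using G(1) by (auto simp: multigraph_def)
  moreover obtain a b where "a \<in> \<Union>(ends G ` D)" "b \<in> \<Union>(ends G ` D)" "a \<noteq> b"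
    using circuit_two_vertices[OF G(1) D] .
  ultimately have "\<exists>c'. (\<forall>x\<in>\<Union>(ends G ` D). c' x = c x) \<and>
      edges G - D \<subseteq> bichromatic_edges (ends G) c'"
    using ear_parity_colouring_extends[OF G _ _ _ _ Diff_subset _ colouring] by blast
  then show thesis
    using that by blast
qed

lemma even_circuit_colouring:
  assumes G: "multigraph G" and D: "D \<in> circuits G" "even (card D)"
  shows "\<exists>c. D \<subseteq> bichromatic_edges (ends G) c"
proof -
  obtain u v where "u \<in> \<Union>(ends G ` D)" "v \<in> \<Union>(ends G ` D)" "u \<noteq> v"
    using circuit_two_vertices[OF G D(1)] .
  then obtain A WA B WB
    where split: "internally_disjoint_arcs (ends G) u A WA B WB v" "A \<union> B = D"
    using circuit_split[OF G D(1)] by metis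
  then have A: "arc (ends G) u A WA v" and B: "ear (ends G) B WA u B WB v"
    by (auto simp: internally_disjoint_arcs_def ear_def)
  obtain c where c: "A \<subseteq> bichromatic_edges (ends G) c"
    using arc_colouring_exists[OF A] by metis
  have "card D = card A + card B"
    using card_internally_disjoint_arcs split by metis
  then have "odd (card B) \<longleftrightarrow> c u \<noteq> c v"
    using odd_card_bichromatic_arc_iff[OF A c] D(2) by auto
  then obtain c' where c': "\<forall>x\<in>WA. c' x = c x" "B \<subseteq> bichromatic_edges (ends G) c'"
    using ear_colouring_exists[OF B] by metis
  have "e \<in> bichromatic_edges (ends G) c'" if "e \<in> A" for e
  proof -
    have "c' x = c x" if "x \<in> ends G e" for x
      using that \<open>e \<in> A\<close> arc_ends_subset[OF A] c'(1) by blast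
    then show ?thesis
      using bichromatic_edges_cong[of "ends G" e c' c] c \<open>e \<in> A\<close> by blast
  qed
  then show ?thesis
    using c'(2) split(2) by blast
qed

section \<open>Totally odd subdivisions\<close>

lemma path_joining_arc:
  assumes "arc en u F W v" "u \<noteq> v"
  shows "path_joining {u, v} (edge_induced en F)"
proof -
  let ?en = "case_option {u, v} en"
  have "arc (case_option D en) u (Some ` F) W v" for D
    using assms(1) by (induction rule: arc.induct) (auto intro: arc.intros)
  moreover have "arc ?en u {None} {u, v} v"
    using assms(2) by (intro arc_single) auto
  ultimately have "internally_disjoint_arcs ?en u (Some ` F) W {None} {u, v} v"
    using assms(2) arc_endpoints[OF assms(1)] by (auto simp: internally_disjoint_arcs_def)
  then have "circuit_graph (edge_induced ?en (Some ` F \<union> {None}))"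
    by (rule internally_disjoint_arcs_circuit_graph)
  moreover have "{u, v} \<union> \<Union>(en ` F) = \<Union>(en ` F)"
    using arc_verts[OF assms] arc_endpoints[OF assms(1)] by auto
  ultimately show ?thesis
    by (simp add: path_joining_def add_new_edge_def edge_induced_def)
qed

lemma boundary_path_joining:
  assumes "path_joining D P"
  shows "boundary (ends P) (edges P) = D"
proof -
  let ?C = "add_new_edge P D"
  have C: "circuit_graph ?C"
    using assms by (simp add: path_joining_def)
  then have "finite (edges P)"
    by (auto simp: circuit_graph_def multigraph_def add_new_edge_def finite_image_iff)
  have "card (incident (ends ?C) (edges ?C) x) =
      of_bool (x \<in> D) + card (incident (ends P) (edges P) x)" for x
  proof -
    have "incident (ends ?C) (edges ?C) x =
        (if x \<in> D then {None} else {}) \<union> Some ` incident (ends P) (edges P) x"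
      by (auto simp: add_new_edge_def incident_def)
    then show ?thesis
      using \<open>finite (edges P)\<close> by (auto simp: finite_incident card_image card_insert_if)
  qed
  then have "even (of_bool (x \<in> D) + card (incident (ends P) (edges P) x))" for x
    using boundary_circuit_graph[OF C] unfolding boundary_def
    by (metis (mono_tags, lifting) empty_iff mem_Collect_eq)
  then have "odd (card (incident (ends P) (edges P) x)) \<longleftrightarrow> x \<in> D" for x
    by (metis even_add odd_one of_bool_eq(1,2) even_zero)
  then show ?thesis
    by (simp add: boundary_def)
qed

lemma even_card_UN_odd_iff:
  assumes "finite X" and F: "\<And>e. e \<in> X \<Longrightarrow> odd (card (F e))"
    and "\<And>e f. e \<in> X \<Longrightarrow> f \<in> X \<Longrightarrow> e \<noteq> f \<Longrightarrow> F e \<inter> F f = {}"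
  shows "even (card (\<Union>e\<in>X. F e)) \<longleftrightarrow> even (card X)"
proof -
  have "finite (F e)" if "e \<in> X" for e
    by (rule ccontr) (use F[OF that] in simp)
  then have "card (\<Union>e\<in>X. F e) = (\<Sum>e\<in>X. card (F e))"
    using assms by (intro card_UN_disjoint) auto
  moreover have "{e \<in> X. odd (card (F e))} = X"
    using F by auto
  ultimately show ?thesis
    using even_sum_iff[OF \<open>finite X\<close>, of "\<lambda>e. card (F e)"] by simp
qed

lemma boundary_UN_replaced_edges:
  assumes "finite X" "inj_on \<phi> (\<Union>(en ` X))"
    and "\<And>e. e \<in> X \<Longrightarrow> finite (F e) \<and> boundary en' (F e) = \<phi> ` en e"
    and "\<And>e f. e \<in> X \<Longrightarrow> f \<in> X \<Longrightarrow> e \<noteq> f \<Longrightarrow> F e \<inter> F f = {}"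
  shows "boundary en' (\<Union>e\<in>X. F e) = \<phi> ` boundary en X"
  using assms
proof (induction rule: finite_induct)
  case empty
  show ?case by (simp add: boundary_empty)
next
  case (insert e X)
  let ?L = "\<Union>f\<in>X. F f"
  have \<phi>: "inj_on \<phi> (\<Union>(en ` insert e X))" "inj_on \<phi> (\<Union>(en ` X))"
    using insert.prems(1) by (auto intro: inj_on_subset)
  have "F e \<inter> ?L = {}"
    using insert.prems(3)[of e] insert.hyps(2) by auto
  then have "(\<Union>f\<in>insert e X. F f) = sym_diff (F e) ?L"
    by auto
  moreover have "boundary en' (sym_diff (F e) ?L) = sym_diff (boundary en' (F e)) (boundary en' ?L)"
    using insert.prems(2) insert.hyps(1) by (intro boundary_sym_diff) auto
  moreover have "boundary en' (F e) = \<phi> ` en e" "boundary en' ?L = \<phi> ` boundary en X"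
    using insert.prems insert.IH[OF \<phi>(2)] by auto
  moreover have "\<phi> ` (en e - boundary en X) = \<phi> ` en e - \<phi> ` boundary en X"
    "\<phi> ` (boundary en X - en e) = \<phi> ` boundary en X - \<phi> ` en e"
    using boundary_subset[of en X] by (intro inj_on_image_set_diff[OF \<phi>(1)]; auto)+
  ultimately show ?case
    unfolding boundary_insert[OF insert.hyps] by (simp add: image_Un)
qed

lemma totally_odd_subdivision_edge_paths:
  fixes H :: "('a, 'b) mgraph" and S :: "('v, 'e) mgraph"
  assumes S: "totally_odd_subdivision H S"
  obtains \<phi> :: "'a \<Rightarrow> 'v" and F :: "'b \<Rightarrow> 'e set" where "inj_on \<phi> (verts H)"
    and "\<And>e. e \<in> edges H \<Longrightarrow> F e \<subseteq> edges S"
    and "\<And>e. e \<in> edges H \<Longrightarrow> odd (card (F e))"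
    and "\<And>e. e \<in> edges H \<Longrightarrow> boundary (ends S) (F e) = \<phi> ` ends H e"
    and "\<And>e f. e \<in> edges H \<Longrightarrow> f \<in> edges H \<Longrightarrow> e \<noteq> f \<Longrightarrow> F e \<inter> F f = {}"
proof -
  obtain \<phi> :: "'a \<Rightarrow> 'v" and P :: "'b \<Rightarrow> ('v, 'e) mgraph" where \<phi>: "inj_on \<phi> (verts H)"
    and P: "\<forall>e\<in>edges H. subgraph (P e) S \<and> path_joining (\<phi> ` ends H e) (P e) \<and>
      odd (card (edges (P e))) \<and> (verts (P e) - \<phi> ` ends H e) \<inter> \<phi> ` verts H = {}"
    and disjoint: "\<forall>e\<in>edges H. \<forall>f\<in>edges H. e \<noteq> f \<longrightarrow> edges (P e) \<inter> edges (P f) = {} \<and>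
      (verts (P e) - \<phi> ` ends H e) \<inter> (verts (P f) - \<phi> ` ends H f) = {}"
    using S unfolding totally_odd_subdivision_def by (elim conjE exE) (rule that)
  have "boundary (ends S) (edges (P e)) = \<phi> ` ends H e" if "e \<in> edges H" for e
  proof -
    have "boundary (ends S) (edges (P e)) = boundary (ends (P e)) (edges (P e))"
      using P that by (intro boundary_cong) (simp add: subgraph_def)
    also have "\<dots> = \<phi> ` ends H e"
      using P that by (intro boundary_path_joining) simp
    finally show ?thesis .
  qed
  moreover have "edges (P e) \<subseteq> edges S" "odd (card (edges (P e)))" if "e \<in> edges H" for e
    using P that by (simp_all add: subgraph_def)
  moreover have "edges (P e) \<inter> edges (P f) = {}"
    if "e \<in> edges H" "f \<in> edges H" "e \<noteq> f" for e f
    using disjoint that by simp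
  ultimately show thesis
    using that[of \<phi> "\<lambda>e. edges (P e)"] \<phi> by simp
qed

lemma totally_odd_subdivision_lift_cycles:
  fixes H :: "('a, 'b) mgraph" and S :: "('v, 'e) mgraph"
  assumes H: "multigraph H" and S: "totally_odd_subdivision H S"
  obtains L where "\<And>X Y. X \<subseteq> edges H \<Longrightarrow> Y \<subseteq> edges H \<Longrightarrow> L X \<inter> L Y = L (X \<inter> Y)"
    and "\<And>X. X \<subseteq> edges H \<Longrightarrow> L X \<subseteq> edges S"
    and "\<And>X. X \<subseteq> edges H \<Longrightarrow> even (card (L X)) \<longleftrightarrow> even (card X)"
    and "\<And>X. X \<subseteq> edges H \<Longrightarrow> boundary (ends H) X = {} \<Longrightarrow> boundary (ends S) (L X) = {}"
proof -
  obtain \<phi> :: "'a \<Rightarrow> 'v" and F :: "'b \<Rightarrow> 'e set" where \<phi>: "inj_on \<phi> (verts H)"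
    and subset: "\<And>e. e \<in> edges H \<Longrightarrow> F e \<subseteq> edges S"
    and odd: "\<And>e. e \<in> edges H \<Longrightarrow> odd (card (F e))"
    and boundary: "\<And>e. e \<in> edges H \<Longrightarrow> boundary (ends S) (F e) = \<phi> ` ends H e"
    and disjoint: "\<And>e f. e \<in> edges H \<Longrightarrow> f \<in> edges H \<Longrightarrow> e \<noteq> f \<Longrightarrow> F e \<inter> F f = {}"
    by (rule totally_odd_subdivision_edge_paths[OF S]) (rule that)
  define L where "L X = (\<Union>e\<in>X. F e)" for X
  have "L X \<inter> L Y = L (X \<inter> Y)" if XY: "X \<subseteq> edges H" "Y \<subseteq> edges H" for X Y
  proof -
    have "e = f" if "e \<in> X" "f \<in> Y" "d \<in> F e" "d \<in> F f" for d e f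
      using that XY disjoint[of e f] by auto
    then show ?thesis
      by (auto simp: L_def)
  qed
  moreover have "L X \<subseteq> edges S" if "X \<subseteq> edges H" for X
    unfolding L_def using that subset by (intro UN_least) auto
  moreover have "even (card (L X)) \<longleftrightarrow> even (card X)"
    "boundary (ends S) (L X) = \<phi> ` boundary (ends H) X"
    if X: "X \<subseteq> edges H" for X
  proof -
    have "finite X" "inj_on \<phi> (\<Union>(ends H ` X))"
      using X H by (auto simp: multigraph_def intro: finite_subset inj_on_subset[OF \<phi>])
    moreover have "finite (F e)" if "e \<in> X" for e
      by (rule ccontr) (use odd[of e] that X in auto)
    moreover note in_H = subsetD[OF X]
    ultimately show "even (card (L X)) \<longleftrightarrow> even (card X)"
      "boundary (ends S) (L X) = \<phi> ` boundary (ends H) X"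
      unfolding L_def
      by (intro even_card_UN_odd_iff boundary_UN_replaced_edges conjI odd boundary disjoint in_H;
          blast)+
  qed
  ultimately show thesis
    using that[of L] by simp
qed

lemma odd_C3_plus_imp_odd_cycles_meeting_evenly:
  assumes S: "totally_odd_subdivision C3_plus S"
  shows "\<exists>C D. C \<subseteq> edges S \<and> D \<subseteq> edges S \<and> boundary (ends S) C = {} \<and>
    boundary (ends S) D = {} \<and> odd (card C) \<and> odd (card D) \<and> even (card (C \<inter> D))"
proof -
  have edges: "{0, 1, i} \<subseteq> edges C3_plus" "boundary (ends C3_plus) {0, 1, i} = {}"
    if "i \<in> {2, 3}" for i
    using that by (auto simp: C3_plus_def boundary_insert boundary_empty)
  have "multigraph C3_plus"
    by (auto simp: C3_plus_def multigraph_def)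
  then obtain L where L:
      "\<And>X Y. X \<subseteq> edges C3_plus \<Longrightarrow> Y \<subseteq> edges C3_plus \<Longrightarrow> L X \<inter> L Y = L (X \<inter> Y)"
      "\<And>X. X \<subseteq> edges C3_plus \<Longrightarrow> L X \<subseteq> edges S"
      "\<And>X. X \<subseteq> edges C3_plus \<Longrightarrow> even (card (L X)) \<longleftrightarrow> even (card X)"
      "\<And>X. X \<subseteq> edges C3_plus \<Longrightarrow> boundary (ends C3_plus) X = {} \<Longrightarrow>
        boundary (ends S) (L X) = {}"
    using totally_odd_subdivision_lift_cycles[OF _ S] by metis
  have "{0, 1, 2} \<inter> {0, 1, 3} = {0, 1 :: nat}" "{0, 1} \<subseteq> edges C3_plus"
    using edges(1)[of 2] by auto
  then have "even (card (L {0, 1, 2} \<inter> L {0, 1, 3}))"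
    using L(1)[of "{0, 1, 2}" "{0, 1, 3}"] L(3)[of "{0, 1}"] edges(1)[of 2] edges(1)[of 3] by simp
  moreover have "odd (card (L {0, 1, 2}))" "odd (card (L {0, 1, 3}))"
    using L(3)[of "{0, 1, 2}"] L(3)[of "{0, 1, 3}"] edges(1)[of 2] edges(1)[of 3] by simp_all
  ultimately show ?thesis
    by (intro exI[of _ "L {0, 1, 2}"] exI[of _ "L {0, 1, 3}"] conjI L(2,4) edges) simp_all
qed

lemma path_joining_multigraph:
  assumes "path_joining D P"
  shows "multigraph P" "D \<subseteq> verts P"
  using assms
  by (auto simp: path_joining_def circuit_graph_def multigraph_def add_new_edge_def finite_image_iff)

lemma totally_odd_subdivision_edge_induced:
  assumes H: "finite (edges H)" "verts H = \<Union>(ends H ` edges H)" and \<phi>: "inj_on \<phi> (verts H)"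
    and paths: "\<And>e. e \<in> edges H \<Longrightarrow> path_joining (\<phi> ` ends H e) (edge_induced en (F e))"
    and odd: "\<And>e. e \<in> edges H \<Longrightarrow> odd (card (F e))"
    and branch: "\<And>e. e \<in> edges H \<Longrightarrow> \<Union>(en ` F e) \<inter> \<phi> ` verts H \<subseteq> \<phi> ` ends H e"
    and disjoint: "\<And>e f. e \<in> edges H \<Longrightarrow> f \<in> edges H \<Longrightarrow> e \<noteq> f \<Longrightarrow>
      F e \<inter> F f = {} \<and> \<Union>(en ` F e) \<inter> \<Union>(en ` F f) \<subseteq> \<phi> ` ends H e"
  shows "totally_odd_subdivision H (edge_induced en (\<Union>e\<in>edges H. F e))"
    (is "totally_odd_subdivision H ?S")
proof -
  define P where "P e = edge_induced en (F e)" for e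
  have verts: "verts ?S = (\<Union>e\<in>edges H. \<Union>(en ` F e))"
    by simp
  have "finite (\<Union>(en ` F e))" "finite (F e)" "\<forall>d\<in>F e. card (en d) = 2" if "e \<in> edges H" for e
    using path_joining_multigraph(1)[OF paths[OF that]] by (simp_all add: multigraph_def)
  then have S: "multigraph ?S"
    unfolding multigraph_def verts using H(1) by (intro conjI finite_UN_I ballI) auto
  have "\<forall>e\<in>edges H. subgraph (P e) ?S \<and> path_joining (\<phi> ` ends H e) (P e) \<and>
      odd (card (edges (P e))) \<and> (verts (P e) - \<phi> ` ends H e) \<inter> \<phi> ` verts H = {}"
  proof (intro ballI conjI)
    fix e assume e: "e \<in> edges H"
    then have "F e \<subseteq> edges ?S"
      by auto
    then show "subgraph (P e) ?S"
      using subgraph_edge_induced[OF S] by (simp add: P_def)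
    show "path_joining (\<phi> ` ends H e) (P e)" "odd (card (edges (P e)))"
      using paths[OF e] odd[OF e] by (simp_all add: P_def)
    show "(verts (P e) - \<phi> ` ends H e) \<inter> \<phi> ` verts H = {}"
      using branch[OF e] by (auto simp: P_def)
  qed
  moreover have "\<forall>e\<in>edges H. \<forall>f\<in>edges H. e \<noteq> f \<longrightarrow> edges (P e) \<inter> edges (P f) = {} \<and>
      (verts (P e) - \<phi> ` ends H e) \<inter> (verts (P f) - \<phi> ` ends H f) = {}"
  proof (intro ballI impI)
    fix e f assume "e \<in> edges H" "f \<in> edges H" "e \<noteq> f"
    then show "edges (P e) \<inter> edges (P f) = {} \<and>
        (verts (P e) - \<phi> ` ends H e) \<inter> (verts (P f) - \<phi> ` ends H f) = {}"
      using disjoint[of e f] by (auto simp: P_def)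
  qed
  moreover have "\<phi> ` verts H \<subseteq> verts ?S"
    using path_joining_multigraph(2)[OF paths] unfolding H(2) by fastforce
  then have "verts ?S = \<phi> ` verts H \<union> (\<Union>e\<in>edges H. verts (P e))"
    by (auto simp: P_def)
  moreover have "edges ?S = (\<Union>e\<in>edges H. edges (P e))"
    by (simp add: P_def)
  ultimately show ?thesis
    unfolding totally_odd_subdivision_def using S \<phi> by (intro conjI exI[of _ \<phi>] exI[of _ P])
qed

lemma totally_odd_subdivision_C3_plus_of_arcs:
  assumes arcs: "arc en a F0 W0 b" "arc en b F1 W1 c" "arc en a F2 W2 c" "arc en a F3 W3 c"
    and distinct: "a \<noteq> b" "b \<noteq> c" "a \<noteq> c"
    and odd: "odd (card F0)" "odd (card F1)" "odd (card F2)" "odd (card F3)"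
    and meet: "W0 \<inter> W1 = {b}" "W0 \<inter> W2 = {a}" "W0 \<inter> W3 = {a}" "W1 \<inter> W2 = {c}"
      "W1 \<inter> W3 = {c}" "W2 \<inter> W3 = {a, c}" "F2 \<inter> F3 = {}"
  shows "totally_odd_subdivision C3_plus (edge_induced en (F0 \<union> F1 \<union> F2 \<union> F3))"
proof -
  let ?\<phi> = "(!) [a, b, c]" and ?F = "(!) [F0, F1, F2, F3]" and ?W = "(!) [W0, W1, W2, W3]"
  have outside: "c \<notin> W0" "a \<notin> W1" "b \<notin> W2" "b \<notin> W3"
    using IntI[of c W0 W1] IntI[of a W0 W1] IntI[of b W0 W2] IntI[of b W0 W3]
      arcs[THEN arc_endpoints] distinct unfolding meet by auto
  note F = arcs_edge_disjoint[OF arcs(1,2) equalityD1[OF meet(1)]]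
    arcs_edge_disjoint[OF arcs(1,3) equalityD1[OF meet(2)]]
    arcs_edge_disjoint[OF arcs(1,4) equalityD1[OF meet(3)]]
    arcs_edge_disjoint[OF arcs(2,3) equalityD1[OF meet(4)]]
    arcs_edge_disjoint[OF arcs(2,4) equalityD1[OF meet(5)]]
  note disjoint = meet F meet[THEN trans[OF Int_commute]] F[THEN trans[OF Int_commute]]
  have edges: "edges C3_plus = {0, 1, 2, 3}"
    by (simp add: C3_plus_def)
  have W: "\<Union>(en ` ?F i) = ?W i" if "i \<in> edges C3_plus" for i
    using that distinct arc_verts[OF arcs(1)] arc_verts[OF arcs(2)] arc_verts[OF arcs(3)]
      arc_verts[OF arcs(4)] unfolding edges by (elim insertE emptyE) simp_all
  have "totally_odd_subdivision C3_plus (edge_induced en (\<Union>i\<in>edges C3_plus. ?F i))"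
  proof (rule totally_odd_subdivision_edge_induced)
    show "finite (edges C3_plus)" "verts C3_plus = \<Union>(ends C3_plus ` edges C3_plus)"
      "inj_on ?\<phi> (verts C3_plus)"
      using distinct by (auto simp: C3_plus_def inj_on_def)
    fix i assume i: "i \<in> edges C3_plus"
    then show "path_joining (?\<phi> ` ends C3_plus i) (edge_induced en (?F i))" "odd (card (?F i))"
      using arcs[THEN path_joining_arc] distinct odd unfolding edges by (auto simp: C3_plus_def)
    show "\<Union>(en ` ?F i) \<inter> ?\<phi> ` verts C3_plus \<subseteq> ?\<phi> ` ends C3_plus i"
      unfolding W[OF i] using i outside by (auto simp: C3_plus_def)
    fix j assume j: "j \<in> edges C3_plus" "i \<noteq> j"
    show "?F i \<inter> ?F j = {} \<and> \<Union>(en ` ?F i) \<inter> \<Union>(en ` ?F j) \<subseteq> ?\<phi> ` ends C3_plus i"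
      using i j unfolding W[OF i] W[OF j(1)] edges
      by (elim insertE emptyE) (simp_all add: C3_plus_def disjoint)
  qed
  moreover have "(\<Union>i\<in>edges C3_plus. ?F i) = F0 \<union> F1 \<union> F2 \<union> F3"
    by (auto simp: C3_plus_def)
  ultimately show ?thesis by simp
qed

lemma even_arc_first_edge:
  assumes B: "arc en u B WB v" "even (card B)" and "u \<noteq> v"
  obtains b w B' WB' where "B = insert b B'" "WB = insert u WB'" "arc en u {b} {u, w} w"
    "arc en w B' WB' v" "u \<notin> WB'" "u \<noteq> w" "w \<noteq> v" "odd (card B')"
proof -
  obtain b w B' WB' where b: "B = insert b B'" "WB = insert u WB'" "en b = {u, w}"
      "arc en w B' WB' v" "u \<notin> WB'"
    using B(1) \<open>u \<noteq> v\<close> by (cases rule: arc.cases) auto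
  have "u \<noteq> w"
    using b(5) arc_endpoints[OF b(4)] by auto
  moreover have "b \<notin> B'"
    using arc_ends_subset[OF b(4)] b(3,5) by auto
  then have B': "odd (card B')"
    using B(2) b(1) arc_finite[OF b(4)] by simp
  moreover from this have "w \<noteq> v"
    using arc_trivial[of en v B' WB'] b(4) by auto
  ultimately show thesis
    using that b arc_single[of en b u w] by blast
qed

lemma odd_theta_not_odd_C3_plus_free:
  assumes G: "multigraph G"
    and AB: "internally_disjoint_arcs (ends G) u A WA B WB v"
    and AP: "internally_disjoint_arcs (ends G) u A WA P WP v"
    and BP: "internally_disjoint_arcs (ends G) u B WB P WP v"
    and edges: "A \<union> B \<union> P \<subseteq> edges G"
    and parity: "odd (card A)" "even (card B)" "odd (card P)"
  shows "\<not> odd_C3_plus_free G"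
proof -
  have A: "arc (ends G) u A WA v" and B: "arc (ends G) u B WB v" and P: "arc (ends G) u P WP v"
    and "u \<noteq> v" and meet: "WA \<inter> WB = {u, v}" "WA \<inter> WP = {u, v}" "WB \<inter> WP = {u, v}" "A \<inter> P = {}"
    using AB AP BP by (simp_all add: internally_disjoint_arcs_def)
  obtain b w B' WB' where b: "B = insert b B'" "WB = insert u WB'" "arc (ends G) u {b} {u, w} w"
      "arc (ends G) w B' WB' v" "u \<notin> WB'" "u \<noteq> w" "w \<noteq> v" "odd (card B')"
    by (rule even_arc_first_edge[OF B parity(2) \<open>u \<noteq> v\<close>])
  have mem: "w \<in> WB'" "v \<in> WB'"
    using arc_endpoints[OF b(4)] by auto
  have uv: "u \<in> WA" "v \<in> WA" "u \<in> WP" "v \<in> WP"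
    using meet by auto
  have WB': "WB' \<inter> WA = {v}" "WB' \<inter> WP = {v}"
    using meet(1,3) b(2,5) mem uv by auto
  then have "w \<notin> WA" "w \<notin> WP"
    using mem(1) b(7) by auto
  then have "{u, w} \<inter> WB' = {w}" "{u, w} \<inter> WA = {u}" "{u, w} \<inter> WP = {u}"
    using b(5) mem(1) uv by auto
  then have "totally_odd_subdivision C3_plus (edge_induced (ends G) ({b} \<union> B' \<union> A \<union> P))"
    using b(3,4,6,7,8) A P \<open>u \<noteq> v\<close> parity(1,3) WB' meet(2,4)
    by (intro totally_odd_subdivision_C3_plus_of_arcs[where en = "ends G"]) simp_all
  moreover have "{b} \<union> B' \<union> A \<union> P \<subseteq> edges G"
    using edges b(1) by auto
  ultimately show ?thesis
    using subgraph_edge_induced[OF G] unfolding odd_C3_plus_free_def by blast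
qed

lemma odd_circuit_ear_even:
  assumes G: "multigraph G" and free: "odd_C3_plus_free G"
    and D: "D \<in> circuits G" "odd (card D)"
    and ear: "ear (ends G) (edges G - D) (\<Union>(ends G ` D)) u F W v"
  shows "even (card F)"
proof (rule ccontr)
  assume "odd (card F)"
  obtain A WA B WB where AB: "internally_disjoint_arcs (ends G) u A WA B WB v"
    and AF: "internally_disjoint_arcs (ends G) u A WA F W v"
    and BF: "internally_disjoint_arcs (ends G) u B WB F W v" and "A \<union> B = D"
    using circuit_ear_split[OF G D(1) ear] by blast
  have BA: "internally_disjoint_arcs (ends G) u B WB A WA v"
    using AB by (auto simp: internally_disjoint_arcs_def)
  have "A \<union> B \<union> F \<subseteq> edges G"
    using D(1) ear \<open>A \<union> B = D\<close> by (auto simp: circuits_iff[OF G] ear_def)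
  moreover from this have "B \<union> A \<union> F \<subseteq> edges G" by auto
  moreover have "odd (card A + card B)"
    using D(2) card_internally_disjoint_arcs[OF AB] \<open>A \<union> B = D\<close> by simp
  then consider "odd (card A)" "even (card B)" | "odd (card B)" "even (card A)" by auto
  ultimately show False
    using odd_theta_not_odd_C3_plus_free[OF G AB AF BF]
      odd_theta_not_odd_C3_plus_free[OF G BA BF AF] \<open>odd (card F)\<close> free
    by metis
qed

section \<open>The cycle space\<close>

lemma incidence_vector_sym_diff:
  "incidence_vector (sym_diff A B) = incidence_vector A + incidence_vector B"
  by (auto simp: incidence_vector_def fun_eq_iff)

lemma incidence_vector_empty: "incidence_vector {} = 0"
  by (auto simp: incidence_vector_def fun_eq_iff)

lemma of_nat_bit: "(of_nat n :: bit) = of_bool (odd n)"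
  by (induction n) auto

lemma sum_incidence_vector:
  assumes "finite E" "C \<subseteq> E"
  shows "(\<Sum>e\<in>E. incidence_vector C e) = of_bool (odd (card C))"
proof -
  have "(\<Sum>e\<in>E. incidence_vector C e) = (\<Sum>e\<in>C. 1)"
    using assms unfolding incidence_vector_def by (intro sum.mono_neutral_cong_right) auto
  then show ?thesis by (simp add: of_nat_bit)
qed

lemma sum_incidence_vector_mult:
  assumes "finite E" "C \<subseteq> E"
  shows "(\<Sum>e\<in>E. incidence_vector C e * incidence_vector D e) = of_bool (odd (card (C \<inter> D)))"
proof -
  have "incidence_vector C e * incidence_vector D e = incidence_vector (C \<inter> D) e" for e
    by (auto simp: incidence_vector_def)
  moreover have "C \<inter> D \<subseteq> E"
    using assms(2) by auto
  ultimately show ?thesis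
    using sum_incidence_vector[OF assms(1), of "C \<inter> D"] by (simp del: mult_bit_eq_and)
qed

lemma dot_product_eq_product_of_sums_on_span:
  fixes E :: "'e set" and X :: "('e \<Rightarrow> bit) set"
  assumes X: "\<And>x y. x \<in> X \<Longrightarrow> y \<in> X \<Longrightarrow> (\<Sum>e\<in>E. x e * y e) = sum x E * sum y E"
    and x: "x \<in> F2.span X" and y: "y \<in> F2.span X"
  shows "(\<Sum>e\<in>E. x e * y e) = sum x E * sum y E"
proof -
  define agree where "agree z = {x. (\<Sum>e\<in>E. x e * z e) = sum x E * sum z E}" for z :: "'e \<Rightarrow> bit"
  have subspace: "F2.subspace (agree z)" for z
    unfolding F2.subspace_def agree_def
    by (simp add: F2_scale_def distrib_right sum.distrib mult.assoc sum_distrib_left[symmetric]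
        del: add_bit_eq_xor mult_bit_eq_and)
  have sym: "x \<in> agree z \<longleftrightarrow> z \<in> agree x" for x z
    by (simp add: agree_def mult.commute del: mult_bit_eq_and)
  have "X \<subseteq> agree z" if "z \<in> X" for z
    using X that by (auto simp: agree_def)
  then have "F2.span X \<subseteq> agree z" if "z \<in> X" for z
    using that by (intro F2.span_minimal subspace)
  then have "X \<subseteq> agree x"
    using x sym by blast
  then have "F2.span X \<subseteq> agree x"
    by (intro F2.span_minimal subspace)
  then have "x \<in> agree y"
    using y sym by blast
  then show ?thesis
    by (simp add: agree_def)
qed

lemma circuits_subset_cycles: "circuits G \<subseteq> cycles G"
proof
  fix C assume "C \<in> circuits G"
  then have "{C} \<subseteq> circuits G" "disjoint {C}" by auto
  then show "C \<in> cycles G"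
    unfolding cycles_def by force
qed

lemma circuits_subset_Pow: "circuits G \<subseteq> Pow (edges G)"
  by (auto simp: circuits_def subgraph_def)

lemma cycles_subset_Pow: "cycles G \<subseteq> Pow (edges G)"
  using circuits_subset_Pow by (fastforce simp: cycles_def)

lemma incidence_vector_cycle_in_cycle_space:
  "C \<in> cycles G \<Longrightarrow> incidence_vector C \<in> cycle_space G"
  unfolding cycle_space_def by (intro F2.span_base imageI)

lemma incidence_vector_disjoint_Union_in_span:
  assumes "finite \<C>" "disjoint \<C>"
  shows "incidence_vector (\<Union>\<C>) \<in> F2.span (incidence_vector ` \<C>)"
  using assms
proof (induction rule: finite_induct)
  case empty
  show ?case
    by (metis Union_empty incidence_vector_empty F2.span_zero)
next
  case (insert C \<C>)
  have "disjoint \<C>"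
    using insert.prems by (simp add: pairwise_insert)
  then have "incidence_vector (\<Union>\<C>) \<in> F2.span (incidence_vector ` insert C \<C>)"
    using insert.IH F2.span_mono[of "incidence_vector ` \<C>" "incidence_vector ` insert C \<C>"] by auto
  moreover have "incidence_vector C \<in> F2.span (incidence_vector ` insert C \<C>)"
    by (simp add: F2.span_base)
  moreover have "C \<inter> \<Union>\<C> = {}"
    using insert.prems insert.hyps by (auto simp: disjoint_def)
  then have "\<Union>(insert C \<C>) = sym_diff C (\<Union>\<C>)" by auto
  ultimately show ?case
    by (metis incidence_vector_sym_diff F2.span_add)
qed

lemma cycle_space_eq_span_circuits:
  assumes "multigraph G"
  shows "cycle_space G = F2.span (incidence_vector ` circuits G)"
proof
  have fin: "finite (circuits G)"
    using assms circuits_subset_Pow by (metis finite_Pow_iff finite_subset multigraph_def)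
  have "incidence_vector C \<in> F2.span (incidence_vector ` circuits G)"
    if C: "C \<in> cycles G" for C
  proof -
    obtain \<C> where \<C>: "C = \<Union>\<C>" "\<C> \<subseteq> circuits G" "disjoint \<C>"
      using C by (auto simp: cycles_def)
    then have "incidence_vector C \<in> F2.span (incidence_vector ` \<C>)"
      using incidence_vector_disjoint_Union_in_span[OF finite_subset[OF \<C>(2) fin]] by simp
    then show ?thesis
      using F2.span_mono[OF image_mono[OF \<C>(2)]] by blast
  qed
  then show "cycle_space G \<subseteq> F2.span (incidence_vector ` circuits G)"
    unfolding cycle_space_def by (intro F2.span_minimal) auto
  show "F2.span (incidence_vector ` circuits G) \<subseteq> cycle_space G"
    unfolding cycle_space_def by (intro F2.span_mono image_mono circuits_subset_cycles)
qed

lemma boundaryless_in_cycle_space: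
  assumes G: "multigraph G" and "F \<subseteq> edges G" "boundary (ends G) F = {}"
  shows "incidence_vector F \<in> cycle_space G"
  using assms(2,3)
proof (induction "card F" arbitrary: F rule: less_induct)
  case less
  have "finite F"
    using less.prems(1) G by (metis finite_subset multigraph_def)
  show ?case
  proof (cases "F = {}")
    case True
    then show ?thesis
      by (simp add: incidence_vector_empty cycle_space_def F2.span_zero)
  next
    case False
    then obtain D where D: "D \<in> circuits G" "D \<subseteq> F"
      using boundaryless_contains_circuit[OF G less.prems(1) _ less.prems(2)] by blast
    then have "D \<noteq> {}" "boundary (ends G) D = {}"
      using circuit_two_vertices[OF G] boundary_circuit[OF G] by blast+
    moreover have "F - D = sym_diff F D" and F: "F = sym_diff D (F - D)"
      using D(2) by auto
    ultimately have "boundary (ends G) (F - D) = {}"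
      using boundary_sym_diff[of F D "ends G"] \<open>finite F\<close> D(2) less.prems(2)
      by (simp add: finite_subset)
    moreover have "card (F - D) < card F"
      using \<open>D \<noteq> {}\<close> D(2) \<open>finite F\<close> by (intro psubset_card_mono) auto
    ultimately have "incidence_vector (F - D) \<in> cycle_space G"
      using less.hyps less.prems(1) by blast
    moreover have "incidence_vector D \<in> cycle_space G"
      using D(1) circuits_subset_cycles incidence_vector_cycle_in_cycle_space by blast
    ultimately have "incidence_vector (sym_diff D (F - D)) \<in> cycle_space G"
      unfolding incidence_vector_sym_diff cycle_space_def by (intro F2.span_add)
    then show ?thesis
      using F by simp
  qed
qed

section \<open>Totally odd bases\<close>

lemma totally_odd_basis_odd_card_Int_iff:
  assumes G: "multigraph G" and B: "totally_odd_cycle_basis G B"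
    and C: "C \<subseteq> edges G" "incidence_vector C \<in> cycle_space G"
    and D: "D \<subseteq> edges G" "incidence_vector D \<in> cycle_space G"
  shows "odd (card (C \<inter> D)) \<longleftrightarrow> odd (card C) \<and> odd (card D)"
proof -
  have fin: "finite (edges G)"
    using G by (simp add: multigraph_def)
  have basis: "odd_cycle_basis G B" and cycles: "B \<subseteq> cycles G"
    and span: "F2.span (incidence_vector ` B) = cycle_space G"
    using B by (auto simp: totally_odd_cycle_basis_def odd_cycle_basis_def cycle_basis_def)
  have on_basis: "(\<Sum>e\<in>edges G. x e * y e) = sum x (edges G) * sum y (edges G)"
    if xy: "x \<in> incidence_vector ` B" "y \<in> incidence_vector ` B" for x y
  proof -
    obtain b b' where x: "b \<in> B" "x = incidence_vector b" and y: "b' \<in> B" "y = incidence_vector b'"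
      using xy by blast
    moreover have "odd (card (b \<inter> b'))" "odd (card b)" "odd (card b')"
      using x(1) y(1) B basis
      by (cases "b = b'"; auto simp: totally_odd_cycle_basis_def odd_cycle_basis_def)+
    moreover have "b \<subseteq> edges G" "b' \<subseteq> edges G"
      using x(1) y(1) cycles cycles_subset_Pow by blast+
    ultimately show ?thesis
      by (simp add: sum_incidence_vector_mult sum_incidence_vector fin del: mult_bit_eq_and)
  qed
  have "(\<Sum>e\<in>edges G. incidence_vector C e * incidence_vector D e) =
      sum (incidence_vector C) (edges G) * sum (incidence_vector D) (edges G)"
    using dot_product_eq_product_of_sums_on_span[OF on_basis] C(2) D(2)
    unfolding span[symmetric] by blast
  then show ?thesis
    unfolding sum_incidence_vector_mult[OF fin C(1)] sum_incidence_vector[OF fin C(1)]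
      sum_incidence_vector[OF fin D(1)]
    by (auto split: if_splits)
qed

lemma totally_odd_basis_imp_odd_C3_plus_free:
  assumes G: "multigraph G" and B: "totally_odd_cycle_basis G B"
  shows "odd_C3_plus_free G"
  unfolding odd_C3_plus_free_def
proof
  assume "\<exists>S. subgraph S G \<and> totally_odd_subdivision C3_plus S"
  then obtain S C D where S: "subgraph S G"
    and C: "C \<subseteq> edges S" "boundary (ends S) C = {}"
    and D: "D \<subseteq> edges S" "boundary (ends S) D = {}"
    and parity: "odd (card C)" "odd (card D)" "even (card (C \<inter> D))"
    using odd_C3_plus_imp_odd_cycles_meeting_evenly by metis
  have "F \<subseteq> edges G \<and> incidence_vector F \<in> cycle_space G"
    if "F \<subseteq> edges S" "boundary (ends S) F = {}" for F
  proof
    show "F \<subseteq> edges G"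
      using that(1) S by (auto simp: subgraph_def)
    moreover have "boundary (ends G) F = boundary (ends S) F"
      using that(1) S by (intro boundary_cong) (auto simp: subgraph_def)
    ultimately show "incidence_vector F \<in> cycle_space G"
      using that(2) by (intro boundaryless_in_cycle_space[OF G]) simp_all
  qed
  then have "odd (card (C \<inter> D)) \<longleftrightarrow> odd (card C) \<and> odd (card D)"
    using C D by (intro totally_odd_basis_odd_card_Int_iff[OF G B]) simp_all
  then show False
    using parity by simp
qed

lemma totally_odd_basis_imp_every_odd_basis_totally_odd:
  assumes "multigraph G" "totally_odd_cycle_basis G T" and B: "odd_cycle_basis G B"
  shows "totally_odd_cycle_basis G B"
proof -
  have "C \<subseteq> edges G \<and> incidence_vector C \<in> cycle_space G \<and> odd (card C)" if "C \<in> B" for C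
  proof -
    have "C \<in> cycles G" "odd (card C)"
      using that B by (auto simp: odd_cycle_basis_def cycle_basis_def)
    then show ?thesis
      using cycles_subset_Pow incidence_vector_cycle_in_cycle_space by blast
  qed
  then have "odd (card (C \<inter> D))" if "C \<in> B" "D \<in> B" for C D
    using totally_odd_basis_odd_card_Int_iff[OF assms(1,2)] that by blast
  then show ?thesis
    using B by (simp add: totally_odd_cycle_basis_def)
qed

lemma odd_C3_plus_free_imp_odd_circuits_meet_oddly:
  assumes G: "multigraph G" "two_connected G" and free: "odd_C3_plus_free G"
    and C: "C \<in> circuits G" "odd (card C)" and D: "D \<in> circuits G" "odd (card D)"
  shows "odd (card (C \<inter> D))"
proof -
  have subset: "C \<subseteq> edges G" "D \<subseteq> edges G"
    using C(1) D(1) circuits_subset_Pow by blast+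
  have even_ears: "ear_parity_colouring (ends G) (edges G - C) (\<Union>(ends G ` C)) (\<lambda>_. False)"
    unfolding ear_parity_colouring_def using odd_circuit_ear_even[OF G(1) free C] by blast
  obtain c where c: "\<forall>x\<in>\<Union>(ends G ` C). c x = False"
      "edges G - C \<subseteq> bichromatic_edges (ends G) c"
    by (rule circuit_ear_parity_colouring_extends[OF G C(1) even_ears])
  have "e \<notin> bichromatic_edges (ends G) c" if "e \<in> C" for e
    using that c(1) by (auto simp: bichromatic_edges_def UNIV_bool)
  then have "D \<inter> bichromatic_edges (ends G) c = D - C"
    using c(2) subset(2) by auto
  moreover have "finite D"
    using subset(2) G(1) by (meson finite_subset multigraph_def)
  moreover have "card (ends G e) = 2" if "e \<in> D" for e
    using that subset(2) G(1) by (auto simp: multigraph_def)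
  ultimately have "even (card (D - C))"
    using even_card_bichromatic_edges_iff[of D "ends G" c] boundary_circuit[OF G(1) D(1)] by simp
  then show ?thesis
    using card_Int_Diff[OF \<open>finite D\<close>, of C] D(2) by (simp add: Int_commute)
qed

lemma bichromatic_imp_bipartite_graph:
  assumes G: "multigraph G" and c: "edges G \<subseteq> bichromatic_edges (ends G) c"
  shows "bipartite_graph G"
  unfolding bipartite_graph_def
proof (intro exI conjI ballI)
  show "{x \<in> verts G. c x} \<union> {x \<in> verts G. \<not> c x} = verts G" by auto
  show "{x \<in> verts G. c x} \<inter> {x \<in> verts G. \<not> c x} = {}" by auto
  fix e assume e: "e \<in> edges G"
  obtain x y where xy: "ends G e = {x, y}" "x \<in> verts G" "y \<in> verts G"
    using multigraph_edge[OF G e] by metis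
  then have "c x \<noteq> c y"
    using c e bichromatic_edges_iff[of "ends G" e x y c] by blast
  then show "\<exists>x\<in>{x \<in> verts G. c x}. \<exists>y\<in>{x \<in> verts G. \<not> c x}. ends G e = {x, y}"
    using xy by (cases "c x") (auto simp: insert_commute)
qed

lemma even_circuit_ear_of_wrong_parity:
  assumes G: "multigraph G" "two_connected G" "\<not> bipartite_graph G"
    and D: "D \<in> circuits G" "even (card D)"
  obtains u F W v where "ear (ends G) (edges G - D) (\<Union>(ends G ` D)) u F W v"
    and "\<And>A WA. arc (ends G) u A WA v \<Longrightarrow> A \<subseteq> D \<Longrightarrow> odd (card A + card F)"
proof -
  obtain c where c: "D \<subseteq> bichromatic_edges (ends G) c"
    using even_circuit_colouring[OF G(1) D] by blast
  have "\<not> ear_parity_colouring (ends G) (edges G - D) (\<Union>(ends G ` D)) c"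
  proof
    assume colouring: "ear_parity_colouring (ends G) (edges G - D) (\<Union>(ends G ` D)) c"
    obtain c' where c': "\<forall>x\<in>\<Union>(ends G ` D). c' x = c x"
        "edges G - D \<subseteq> bichromatic_edges (ends G) c'"
      by (rule circuit_ear_parity_colouring_extends[OF G(1,2) D(1) colouring])
    have "e \<in> bichromatic_edges (ends G) c' \<longleftrightarrow> e \<in> bichromatic_edges (ends G) c" if "e \<in> D" for e
      using that c'(1) by (intro bichromatic_edges_cong) auto
    then have "edges G \<subseteq> bichromatic_edges (ends G) c'"
      using c c'(2) by auto
    then show False
      using bichromatic_imp_bipartite_graph[OF G(1)] G(3) by blast
  qed
  then obtain u F W v where ear: "ear (ends G) (edges G - D) (\<Union>(ends G ` D)) u F W v"
    and parity: "odd (card F) \<noteq> (c u \<noteq> c v)"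
    unfolding ear_parity_colouring_def by blast
  have "odd (card A + card F)" if "arc (ends G) u A WA v" "A \<subseteq> D" for A WA
    using odd_card_bichromatic_arc_iff[OF that(1), of c] that(2) c parity by auto
  then show thesis
    by (rule that[OF ear])
qed

lemma even_circuit_eq_sym_diff_odd_circuits:
  assumes G: "multigraph G" "two_connected G" "\<not> bipartite_graph G"
    and D: "D \<in> circuits G" "even (card D)"
  shows "\<exists>C1\<in>circuits G. \<exists>C2\<in>circuits G. odd (card C1) \<and> odd (card C2) \<and> D = sym_diff C1 C2"
proof -
  obtain u F W v where ear: "ear (ends G) (edges G - D) (\<Union>(ends G ` D)) u F W v"
    and parity: "\<And>A WA. arc (ends G) u A WA v \<Longrightarrow> A \<subseteq> D \<Longrightarrow> odd (card A + card F)"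
    using even_circuit_ear_of_wrong_parity[OF assms] by metis
  obtain A WA B WB where AB: "internally_disjoint_arcs (ends G) u A WA B WB v" "A \<union> B = D"
    and AF: "internally_disjoint_arcs (ends G) u A WA F W v"
    and BF: "internally_disjoint_arcs (ends G) u B WB F W v"
    using circuit_ear_split[OF G(1) D(1) ear] by blast
  have F: "F \<subseteq> edges G" "F \<inter> D = {}" and "D \<subseteq> edges G"
    using ear D(1) circuits_subset_Pow by (auto simp: ear_def)
  have "X \<union> F \<in> circuits G \<and> odd (card (X \<union> F))"
    if X: "internally_disjoint_arcs (ends G) u X WX F W v" "X \<subseteq> D" for X WX
  proof
    show "X \<union> F \<in> circuits G"
      using X(2) F(1) \<open>D \<subseteq> edges G\<close> by (intro internally_disjoint_arcs_circuit[OF G(1) X(1)]) auto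
    show "odd (card (X \<union> F))"
      using parity[of X WX] X card_internally_disjoint_arcs[OF X(1)]
      by (simp add: internally_disjoint_arcs_def)
  qed
  then have "A \<union> F \<in> circuits G \<and> odd (card (A \<union> F))" "B \<union> F \<in> circuits G \<and> odd (card (B \<union> F))"
    using AF BF AB(2) by auto
  moreover have "A \<inter> B = {}"
    using AB(1) by (simp add: internally_disjoint_arcs_def)
  then have "D = sym_diff (A \<union> F) (B \<union> F)"
    using AB(2) F(2) by auto
  ultimately show ?thesis by blast
qed

lemma span_odd_circuits:
  assumes G: "multigraph G" "two_connected G" "\<not> bipartite_graph G"
  shows "F2.span (incidence_vector ` {C \<in> circuits G. odd (card C)}) = cycle_space G"
    (is "F2.span ?odd = _")
proof
  show "F2.span ?odd \<subseteq> cycle_space G"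
    unfolding cycle_space_eq_span_circuits[OF G(1)] by (intro F2.span_mono image_mono) auto
  have "incidence_vector D \<in> F2.span ?odd" if D: "D \<in> circuits G" for D
  proof (cases "even (card D)")
    case True
    then obtain C1 C2 where C: "C1 \<in> circuits G" "odd (card C1)" "C2 \<in> circuits G" "odd (card C2)"
        "D = sym_diff C1 C2"
      using even_circuit_eq_sym_diff_odd_circuits[OF G D] by blast
    then show ?thesis
      unfolding C(5) incidence_vector_sym_diff by (intro F2.span_add F2.span_base) auto
  next
    case False
    then show ?thesis
      using D by (intro F2.span_base) auto
  qed
  then show "cycle_space G \<subseteq> F2.span ?odd"
    unfolding cycle_space_eq_span_circuits[OF G(1)] by (intro F2.span_minimal) auto
qed

lemma odd_circuit_basis_exists:
  assumes "multigraph G" "two_connected G" "\<not> bipartite_graph G"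
  shows "\<exists>B. circuit_basis G B \<and> odd_cycle_basis G B"
proof -
  let ?O = "{C \<in> circuits G. odd (card C)}"
  obtain X where X: "X \<subseteq> incidence_vector ` ?O" "F2.independent X"
      "incidence_vector ` ?O \<subseteq> F2.span X"
    using F2.maximal_independent_subset by blast
  then obtain B where B: "B \<subseteq> ?O" "X = incidence_vector ` B"
    by (meson subset_image_iff)
  have "F2.span X = F2.span (incidence_vector ` ?O)"
    using X(1,3) by (meson F2.span_mono F2.span_minimal F2.subspace_span subset_antisym)
  then have "cycle_basis G B"
    using B X(2) span_odd_circuits[OF assms] circuits_subset_cycles[of G]
    by (auto simp: cycle_basis_def)
  then show ?thesis
    using B(1) by (auto simp: circuit_basis_def odd_cycle_basis_def)
qed

lemma odd_C3_plus_free_imp_totally_odd_basis: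
  assumes "multigraph G" "two_connected G" "odd_C3_plus_free G"
    and "circuit_basis G B" "odd_cycle_basis G B"
  shows "totally_odd_cycle_basis G B"
  using odd_C3_plus_free_imp_odd_circuits_meet_oddly[OF assms(1-3)] assms(4,5)
  by (auto simp: totally_odd_cycle_basis_def circuit_basis_def odd_cycle_basis_def subset_iff)

theorem theorem2p2:
  fixes G :: "('v, 'e) mgraph"
  assumes "multigraph G" and "two_connected G" and "\<not> bipartite_graph G"
  shows "(odd_C3_plus_free G \<longleftrightarrow> (\<exists>B. circuit_basis G B \<and> totally_odd_cycle_basis G B)) \<and>
    ((\<exists>B. circuit_basis G B \<and> totally_odd_cycle_basis G B) \<longleftrightarrow>
      (\<forall>B. odd_cycle_basis G B \<longrightarrow> totally_odd_cycle_basis G B))"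
proof -
  obtain B where B: "circuit_basis G B" "odd_cycle_basis G B"
    using odd_circuit_basis_exists[OF assms] by blast
  have "totally_odd_cycle_basis G B" if "odd_C3_plus_free G"
    using odd_C3_plus_free_imp_totally_odd_basis[OF assms(1,2) that B] .
  then show ?thesis
    using B totally_odd_basis_imp_odd_C3_plus_free[OF assms(1)]
      totally_odd_basis_imp_every_odd_basis_totally_odd[OF assms(1)]
    by blast
qed

end
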